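(* Let $d\ge1$ and let $\Psi$ satisfy the coefficient assumption in the context. For any $k\in\{0,1\}$, $\ell\ge0$ and $p\in[1,\infty]$, there exists a constant $C=C(d,\ell,p,k)>0$ such that for all $t>0$, $\zeta>0$ and $j\ge0$, $$\left(\int_{\mathbb R^{2d}}\big|\mathcal R^a_j\partial_\zeta^k(\Gamma_tp_t)(z,\zeta)\big|^p\,dz\right)^{\frac1p}\le C\,2^{4j(d-\frac dp)}\left|\frac{\Psi''(\zeta)}{\Psi'(\zeta)}\right|^k\Big[\Psi'(\zeta)^{-1}\big(2^{-2j}t^{-1}+2^{-6j}t^{-3}\big)\Big]^{\ell}$$ (with the usual modification when $p=\infty$).
   Context: Points of $\mathbb R^{2d}$ are written $z=(x,v)$, $x,v\in\mathbb R^d$. **Coefficient assumption.** $\Psi\in C([0,\infty))$, $\Psi',\Psi''\in C(0,\infty)$, $\Psi(\zeta)>0$, $\Psi'(\zeta)>0$ for all $\zeta>0$, and there are constants $0<r_2<r_1<2$, $\lambda\in(1,2]$, $l\in(0,\frac13)$, $C_0>0$ with $\Psi(\zeta)\le C_0(\zeta^{r_2}+\zeta^{r_1})$ and $|\Psi''(\zeta)/[\Psi'(\zeta)]^{1+l}|\le C_0\zeta^{\lambda-2}$ for all $\zeta>0$. **Kernel.** For $t>0$, $\zeta>0$, $$p_t(x,v,\zeta)=\Big(\tfrac{4\pi^2t^4\Psi'(\zeta)^2}{3}\Big)^{-d/2}\exp\Big\{-\frac{3|x|^2+|3x+2tv|^2}{4t^3\Psi'(\zeta)}\Big\},$$ the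 density of $\big(-\sqrt2\,\Psi'(\zeta)^{1/2}\int_0^tB_s\,ds,\ \sqrt2\,\Psi'(\zeta)^{1/2}B_t\big)$ with $B$ a $d$-dimensional Brownian motion. The operator $\Gamma_t$ is $(\Gamma_th)(x,v):=h(x-tv,v)$, so $(\Gamma_tp_t)(x,v,\zeta)=p_t(x-tv,v,\zeta)$. **Anisotropic blocks** ($a=(3,1)$). For $\xi=(\xi_1,\xi_2)\in\mathbb R^d\times\mathbb R^d$ set $|\xi|_a:=|\xi_1|^{1/3}+|\xi_2|$ and $2^{-aj}\xi:=(2^{-3j}\xi_1,2^{-j}\xi_2)$. Fix a symmetric nonnegative $\chi^a\in C^\infty(\mathbb R^{2d})$ with $\chi^a=1$ on $\{|\xi|_a\le1\}$, $\chi^a=0$ outside $\{|\xi|_a\le4/3\}$. For $j\ge0$, $\phi^a_j(\xi):=\chi^a(2^{-a(j+1)}\xi)-\chi^a(2^{-aj}\xi)$, and $\mathcal R^a_jf:=\mathcal F^{-1}(\phi^a_j\mathcal Ff)$ (acting in the variable $z$). *)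

theory Defs
  imports "HOL-Analysis.Analysis" "HOL-Probability.Essential_Supremum"
begin

text \<open>
  A point of \<open>\<real>\<^sup>2\<^sup>d\<close> is a pair \<open>(x, v)\<close> of vectors in \<open>\<real>\<^sup>d\<close>; the dimension is
  \<open>d = CARD('d)\<close>.  Frequency variables live in the same space.
\<close>

type_synonym 'd phase = "(real ^ 'd) \<times> (real ^ 'd)"

definition coefficient_assumption :: "(real \<Rightarrow> real) \<Rightarrow> bool" where
  "coefficient_assumption \<Psi> \<longleftrightarrow>
     continuous_on {0..} \<Psi> \<and>
     (\<forall>\<zeta>>0. \<Psi> differentiable (at \<zeta>) \<and> deriv \<Psi> differentiable (at \<zeta>)) \<and>
     continuous_on {0<..} (deriv \<Psi>) \<and>
     continuous_on {0<..} (deriv (deriv \<Psi>)) \<and>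
     (\<forall>\<zeta>>0. \<Psi> \<zeta> > 0 \<and> deriv \<Psi> \<zeta> > 0) \<and>
     (\<exists>r1 r2 lam l C0 :: real.
        0 < r2 \<and> r2 < r1 \<and> r1 < 2 \<and> 1 < lam \<and> lam \<le> 2 \<and> 0 < l \<and> l < 1 / 3 \<and> 0 < C0 \<and>
        (\<forall>\<zeta>>0. \<Psi> \<zeta> \<le> C0 * (\<zeta> powr r2 + \<zeta> powr r1)) \<and>
        (\<forall>\<zeta>>0. \<bar>deriv (deriv \<Psi>) \<zeta> / deriv \<Psi> \<zeta> powr (1 + l)\<bar> \<le> C0 * \<zeta> powr (lam - 2)))"

definition kinetic_kernel :: "(real \<Rightarrow> real) \<Rightarrow> real \<Rightarrow> 'd::finite phase \<Rightarrow> real \<Rightarrow> real" where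
  "kinetic_kernel \<Psi> t = (\<lambda>(x, v) \<zeta>.
     (4 * pi\<^sup>2 * t ^ 4 * (deriv \<Psi> \<zeta>)\<^sup>2 / 3) powr (- real CARD('d) / 2) *
     exp (- (3 * (norm x)\<^sup>2 + (norm (3 *\<^sub>R x + (2 * t) *\<^sub>R v))\<^sup>2) / (4 * t ^ 3 * deriv \<Psi> \<zeta>)))"

definition transport :: "real \<Rightarrow> ('d::finite phase \<Rightarrow> 'b) \<Rightarrow> 'd phase \<Rightarrow> 'b" where
  "transport t h = (\<lambda>(x, v). h (x - t *\<^sub>R v, v))"

text \<open>
  The Fourier transform on \<open>L\<^sup>1\<close>, in the unitary normalisation.  The Bochner integral is \<open>0\<close>
  on non-integrable arguments, so these two operators are meaningful on integrable functions only.
\<close>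

definition fourier :: "('a::euclidean_space \<Rightarrow> complex) \<Rightarrow> 'a \<Rightarrow> complex" where
  "fourier f \<xi> =
     of_real ((2 * pi) powr (- real DIM('a) / 2)) * (LINT z|lborel. cis (- (\<xi> \<bullet> z)) * f z)"

definition inverse_fourier :: "('a::euclidean_space \<Rightarrow> complex) \<Rightarrow> 'a \<Rightarrow> complex" where
  "inverse_fourier g z =
     of_real ((2 * pi) powr (- real DIM('a) / 2)) * (LINT \<xi>|lborel. cis (\<xi> \<bullet> z) * g \<xi>)"

text \<open>
  \<open>C\<^sup>k\<close> functions on the whole space: the \<open>k\<close>-th order clause asks for total differentiability and
  for every directional derivative to be of class \<open>C\<^sup>k\<^sup>-\<^sup>1\<close>.
\<close>

primrec times_cont_differentiable :: "nat \<Rightarrow> ('a::euclidean_space \<Rightarrow> real) \<Rightarrow> bool" where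
  "times_cont_differentiable 0 f \<longleftrightarrow> continuous_on UNIV f"
| "times_cont_differentiable (Suc k) f \<longleftrightarrow>
     (\<forall>x. f differentiable (at x)) \<and>
     (\<forall>w. times_cont_differentiable k (\<lambda>x. frechet_derivative f (at x) w))"

definition smooth :: "('a::euclidean_space \<Rightarrow> real) \<Rightarrow> bool" where
  "smooth f \<longleftrightarrow> (\<forall>k. times_cont_differentiable k f)"

definition aniso_norm :: "'d::finite phase \<Rightarrow> real" where
  "aniso_norm = (\<lambda>(\<xi>1, \<xi>2). root 3 (norm \<xi>1) + norm \<xi>2)"

text \<open>The contraction \<open>\<xi> \<mapsto> 2\<^sup>-\<^sup>a\<^sup>j \<xi>\<close> for \<open>a = (3, 1)\<close>.\<close>

definition aniso_contract :: "nat \<Rightarrow> 'd::finite phase \<Rightarrow> 'd phase" where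
  "aniso_contract j = (\<lambda>(\<xi>1, \<xi>2). ((1 / 2 ^ (3 * j)) *\<^sub>R \<xi>1, (1 / 2 ^ j) *\<^sub>R \<xi>2))"

text \<open>Symmetric means even, so that the blocks map real functions to real functions.\<close>

definition aniso_cutoff :: "('d::finite phase \<Rightarrow> real) \<Rightarrow> bool" where
  "aniso_cutoff chi \<longleftrightarrow>
     smooth chi \<and> (\<forall>\<xi>. chi (- \<xi>) = chi \<xi>) \<and> (\<forall>\<xi>. 0 \<le> chi \<xi>) \<and>
     (\<forall>\<xi>. aniso_norm \<xi> \<le> 1 \<longrightarrow> chi \<xi> = 1) \<and>
     (\<forall>\<xi>. aniso_norm \<xi> > 4 / 3 \<longrightarrow> chi \<xi> = 0)"

definition block_symbol :: "('d::finite phase \<Rightarrow> real) \<Rightarrow> nat \<Rightarrow> 'd phase \<Rightarrow> real" where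
  "block_symbol chi j \<xi> = chi (aniso_contract (j + 1) \<xi>) - chi (aniso_contract j \<xi>)"

definition aniso_block ::
  "('d::finite phase \<Rightarrow> real) \<Rightarrow> nat \<Rightarrow> ('d phase \<Rightarrow> real) \<Rightarrow> 'd phase \<Rightarrow> complex" where
  "aniso_block chi j f =
     inverse_fourier (\<lambda>\<xi>. of_real (block_symbol chi j \<xi>) * fourier (\<lambda>z. of_real (f z)) \<xi>)"

text \<open>
  The \<open>L\<^sup>p\<close> norm with respect to Lebesgue measure, for \<open>p \<in> [1, \<infinity>]\<close>, with values in \<open>[0, \<infinity>]\<close>:
  in particular, a bound by a real number includes finiteness of the norm.
\<close>

definition Lp_norm :: "ennreal \<Rightarrow> ('a::euclidean_space \<Rightarrow> complex) \<Rightarrow> ennreal" where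
  "Lp_norm p f =
     (if p = \<infinity> then esssup lborel (\<lambda>z. ennreal (norm (f z)))
      else (let I = (\<integral>\<^sup>+ z. ennreal (norm (f z) powr enn2real p) \<partial>lborel)
            in if I = \<infinity> then \<infinity> else ennreal (enn2real I powr (1 / enn2real p))))"

end

theory Submission
  imports Defs "HOL-Probability.Characteristic_Functions" "HOL-Probability.Sinc_Integral"
    "HOL-Real_Asymp.Real_Asymp"
begin

text \<open>
  With \<open>m = \<Psi>' \<zeta>\<close> and \<open>Q\<^sub>t \<xi> = \<integral>\<^sub>0\<^sup>t \<bar>s \<xi>\<^sub>1 + \<xi>\<^sub>2\<bar>\<^sup>2 ds\<close>, the Fourier transform of the transported kernel is
  \<open>exp (- m Q\<^sub>t)\<close>, and that of its \<open>\<zeta>\<close>-derivative is \<open>- \<Psi>'' \<zeta> / \<Psi>' \<zeta> \<cdot> m Q\<^sub>t exp (- m Q\<^sub>t)\<close>, up to the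
  normalisation.  The dilation \<open>2\<^sup>a\<^sup>j\<close> turns \<open>Q\<^sub>t\<close> into \<open>Q\<^sub>\<tau>\<close> with \<open>\<tau> = 2\<^sup>2\<^sup>j t\<close>, which reduces the claim to
  \<open>j = 0\<close>; the \<open>L\<^sup>p\<close> bound is interpolated between \<open>L\<^sup>1\<close> and \<open>L\<^sup>\<infinity>\<close>.

  Derivatives of \<open>exp (- m Q\<^sub>\<tau>)\<close> are not bounded uniformly in \<open>\<tau>\<close>, so the decay is not obtained by
  differentiating this symbol.  Instead, half of \<open>m Q\<^sub>\<tau>\<close> exceeds \<open>a \<bar>\<xi>\<bar>\<^sup>2\<close> for
  \<open>a = m min \<tau> \<tau>\<^sup>3 / 100\<close> by a positive definite form \<open>R\<close>.  With \<open>a = N b\<close>, on the support of the block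
  symbol \<open>\<phi>\<close>,
  \<open>exp (- m Q\<^sub>\<tau> / 2) \<phi> = exp (- R) \<cdot> b\<^sup>-\<^sup>N (b \<bar>\<xi>\<bar>\<^sup>2 exp (- b \<bar>\<xi>\<bar>\<^sup>2))\<^sup>N \<cdot> \<phi> / \<bar>\<xi>\<bar>\<^sup>2\<^sup>N\<close>.
  Every Gaussian factor is the Fourier transform of a function whose \<open>L\<^sup>1\<close> norm depends only on the
  dimension, hence acts by Young's inequality with a uniform constant, and the last factor is a fixed
  test function.
\<close>

section \<open>Gaussian integrals\<close>

text \<open>The fundamental theorem of calculus on the whole line with vanishing boundary terms; it
  stands in for integration by parts in the moment computation.\<close>

lemma integral_derivative_eq_0:
  fixes F f :: "real \<Rightarrow> 'a::euclidean_space"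
  assumes "\<And>x. (F has_vector_derivative f x) (at x)" "\<And>x. isCont f x" "integrable lborel f"
    and "(F \<longlongrightarrow> 0) at_top" "(F \<longlongrightarrow> 0) at_bot"
  shows "integral\<^sup>L lborel f = 0"
proof -
  have "(LBINT x=-\<infinity>..\<infinity>. f x) = 0 - 0"
    by (rule interval_integral_FTC_integrable[where F = F])
      (use assms in \<open>auto simp: ereal_tendsto_simps set_integrable_def\<close>)
  then show ?thesis
    by (simp add: interval_lebesgue_integral_def set_lebesgue_integral_def)
qed

text \<open>The Jacobian is kept on the integrand, which is the form in which
  \<open>normal_density_scale\<close> reduces a general variance to variance one.\<close>

lemma has_bochner_integral_scale_real:
  fixes f :: "real \<Rightarrow> 'a::{banach, second_countable_topology}"
  assumes "has_bochner_integral lborel (\<lambda>x. \<sigma> *\<^sub>R f (\<sigma> * x)) I" "0 < \<sigma>"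
  shows "has_bochner_integral lborel f I"
proof -
  have "integrable lborel (\<lambda>x. (1 / \<sigma>) *\<^sub>R (\<sigma> *\<^sub>R f (\<sigma> * x)))"
    by (rule integrable_scaleR_right) (use assms(1) in \<open>simp add: has_bochner_integral_iff\<close>)
  also have "(\<lambda>x. (1 / \<sigma>) *\<^sub>R (\<sigma> *\<^sub>R f (\<sigma> * x))) = (\<lambda>x. f (\<sigma> * x))"
    using assms(2) by simp
  finally have "integrable lborel f"
    using assms(2) lborel_integrable_real_affine_iff[of \<sigma> f 0] by simp
  moreover have "integral\<^sup>L lborel f = I"
    using assms lborel_integral_real_affine[of \<sigma> f 0] by (simp add: has_bochner_integral_iff)
  ultimately show ?thesis by (simp add: has_bochner_integral_iff)
qed

section \<open>Characteristic function and second moment of the Gaussian on the line\<close>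

lemma cis_measurable [measurable]: "cis \<in> borel_measurable borel"
  by (intro borel_measurable_continuous_onI continuous_intros)

lemma integrable_cis_mult:
  fixes f :: "'a::euclidean_space \<Rightarrow> complex"
  assumes "integrable lborel f" and [measurable]: "g \<in> borel_measurable borel"
  shows "integrable lborel (\<lambda>x. cis (g x) * f x)"
proof (rule Bochner_Integration.integrable_bound[OF assms(1)])
  show "(\<lambda>x. cis (g x) * f x) \<in> borel_measurable lborel"
    using borel_measurable_integrable[OF assms(1)] by measurable
qed (auto simp: norm_mult)

text \<open>The integrand of the characteristic function of the standard normal law at
  \<open>- \<xi>\<close>; the sign is that of \<open>fourier\<close>.\<close>

definition std_wave :: "real \<Rightarrow> real \<Rightarrow> complex" where
  "std_wave \<xi> x = of_real (std_normal_density x) * cis (- (\<xi> * x))"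

lemma std_wave_integral:
  "has_bochner_integral lborel (std_wave \<xi>) (of_real (exp (- \<xi>\<^sup>2 / 2)))"
proof -
  have "integrable lborel (\<lambda>x. cis (- (\<xi> * x)) * of_real (std_normal_density x))"
    by (intro integrable_cis_mult) auto
  then have "integrable lborel (std_wave \<xi>)"
    by (simp add: std_wave_def[abs_def] mult.commute)
  moreover have "integral\<^sup>L lborel (std_wave \<xi>) = char std_normal_distribution (- \<xi>)"
    unfolding char_def
    by (subst integral_density)
      (auto simp: std_wave_def[abs_def] cis_conv_exp scaleR_conv_of_real mult.commute)
  ultimately show ?thesis
    by (simp add: has_bochner_integral_iff char_std_normal_distribution)
qed


text \<open>This exhibits the function as the restriction of an entire one, so that its derivative
  along the real line can be read off from the complex derivative.\<close>

lemma std_wave_eq_exp: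
  "std_wave \<xi> x = of_real (1 / sqrt (2 * pi)) * exp (- (of_real x)\<^sup>2 / 2 - \<i> * of_real \<xi> * of_real x)"
proof -
  have "exp (- (of_real x)\<^sup>2 / 2 - \<i> * of_real \<xi> * of_real x) =
    of_real (exp (- x\<^sup>2 / 2)) * cis (- (\<xi> * x))"
    unfolding cis_conv_exp exp_of_real[symmetric] exp_add[symmetric] by (rule arg_cong[where f = exp]) simp
  then show ?thesis
    by (simp add: std_wave_def std_normal_density_def)
qed

lemma std_wave_deriv:
  "(std_wave \<xi> has_vector_derivative (- of_real x - \<i> * of_real \<xi>) * std_wave \<xi> x) (at x)"
proof -
  have "((\<lambda>z::complex. of_real (1 / sqrt (2 * pi)) * exp (- z\<^sup>2 / 2 - \<i> * of_real \<xi> * z))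
    has_field_derivative of_real (1 / sqrt (2 * pi)) * (exp (- (of_real x)\<^sup>2 / 2 - \<i> * of_real \<xi> * of_real x) * (- of_real x - \<i> * of_real \<xi>))) (at (of_real x))"
    by (rule DERIV_cmult) (auto intro!: derivative_eq_intros)
  from has_vector_derivative_real_field[OF this] show ?thesis
    unfolding std_wave_eq_exp[abs_def] by (simp add: mult_ac)
qed

lemma std_wave_moment_integrable: "integrable lborel (\<lambda>x. of_real (x ^ k) * std_wave \<xi> x)"
proof -
  have "integrable lborel (\<lambda>x. cis (- (\<xi> * x)) * complex_of_real (std_normal_density x * x ^ k))"
    using integrable_std_normal_moment by (intro integrable_cis_mult integrable_of_real) auto
  then show ?thesis by (simp add: std_wave_def mult_ac)
qed

lemma std_wave_tendsto:
  assumes "((\<lambda>x. x ^ k * std_normal_density x) \<longlongrightarrow> 0) F"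
  shows "((\<lambda>x. of_real (x ^ k) * std_wave \<xi> x) \<longlongrightarrow> 0) F"
proof (rule tendsto_norm_zero_cancel)
  have "norm (of_real (x ^ k) * std_wave \<xi> x) = norm (x ^ k * std_normal_density x)" for x
    by (simp add: std_wave_def norm_mult abs_mult del: of_real_power)
  then show "((\<lambda>x. norm (of_real (x ^ k) * std_wave \<xi> x)) \<longlongrightarrow> 0) F"
    using tendsto_norm_zero[OF assms] by simp
qed

lemma isCont_std_wave: "isCont (std_wave \<xi>) x"
  using std_wave_deriv has_vector_derivative_continuous by blast

text \<open>Integrating \<open>(std_wave \<xi>)'\<close> and \<open>(x std_wave \<xi>)'\<close> over the line gives the first two moments.\<close>

lemma std_wave_second_moment:
  "has_bochner_integral lborel (\<lambda>x. of_real (x\<^sup>2 / 2) * std_wave \<xi> x)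
    (of_real ((1 / 2 - \<xi>\<^sup>2 / 2) * exp (- \<xi>\<^sup>2 / 2)))"
proof -
  let ?E = "std_wave \<xi>"
  define I where "I k = integral\<^sup>L lborel (\<lambda>x. of_real (x ^ k) * ?E x)" for k
  have lim: "((\<lambda>x. x ^ k * std_normal_density x) \<longlongrightarrow> 0) at_top"
    "((\<lambda>x. x ^ k * std_normal_density x) \<longlongrightarrow> 0) at_bot" if "k \<in> {0, 1}" for k
    using that unfolding std_normal_density_def by auto real_asymp+
  have int: "integrable lborel (\<lambda>x. c * (of_real (x ^ k) * ?E x))" for c k
    by (intro integrable_mult_right std_wave_moment_integrable)
  have I: "integral\<^sup>L lborel (\<lambda>x. c * (of_real (x ^ k) * ?E x)) = c * I k" for c k
    by (simp add: I_def)
  have E0: "(?E \<longlongrightarrow> 0) F" if "F \<in> {at_top, at_bot}" for F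
    using std_wave_tendsto[of 0 F \<xi>] lim[of 0] that by auto
  have E1: "((\<lambda>x. of_real x * ?E x) \<longlongrightarrow> 0) F" if "F \<in> {at_top, at_bot}" for F
    using std_wave_tendsto[of 1 F \<xi>] lim[of 1] that by auto
  \<comment> \<open>The powers \<open>x ^ 1\<close> and \<open>x ^ 0\<close> stay unreduced so that
    every summand matches \<open>int\<close> and \<open>I\<close>.\<close>
  have "integral\<^sup>L lborel (\<lambda>x. (-1) * (of_real (x ^ 1) * ?E x) + (- \<i> * of_real \<xi>) * (of_real (x ^ 0) * ?E x)) = 0"
  proof (rule integral_derivative_eq_0[where F = ?E])
    show "(?E has_vector_derivative (-1) * (of_real (x ^ 1) * ?E x) + (- \<i> * of_real \<xi>) * (of_real (x ^ 0) * ?E x)) (at x)" for x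
      using std_wave_deriv[of \<xi> x] by (simp add: algebra_simps)
  qed (intro Bochner_Integration.integrable_add int continuous_intros isCont_std_wave E0; simp)+
  then have 1: "I 1 = - \<i> * of_real \<xi> * I 0"
    by (subst (asm) Bochner_Integration.integral_add, intro int, intro int, unfold I) algebra
  have "integral\<^sup>L lborel (\<lambda>x. 1 * (of_real (x ^ 0) * ?E x) + ((-1) * (of_real (x ^ 2) * ?E x) + (- \<i> * of_real \<xi>) * (of_real (x ^ 1) * ?E x))) = 0"
  proof (rule integral_derivative_eq_0[where F = "\<lambda>x. of_real x * ?E x"])
    show "((\<lambda>x. of_real x * ?E x) has_vector_derivative 1 * (of_real (x ^ 0) * ?E x) + ((-1) * (of_real (x ^ 2) * ?E x) + (- \<i> * of_real \<xi>) * (of_real (x ^ 1) * ?E x))) (at x)" for x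
      by (rule has_vector_derivative_eq_rhs, rule has_vector_derivative_mult[OF has_vector_derivative_of_real[OF DERIV_ident] std_wave_deriv])
        (simp add: algebra_simps power2_eq_square)
  qed (intro Bochner_Integration.integrable_add int continuous_intros isCont_std_wave E1; simp)+
  then have 2: "I 2 = I 0 - \<i> * of_real \<xi> * I 1"
    by (subst (asm) Bochner_Integration.integral_add, intro int, intro Bochner_Integration.integrable_add int,
      subst (asm) Bochner_Integration.integral_add, intro int, intro int, unfold I) algebra
  have "I 0 = of_real (exp (- \<xi>\<^sup>2 / 2))"
    using std_wave_integral[of \<xi>] by (simp add: I_def has_bochner_integral_iff)
  then have "I 2 = of_real ((1 - \<xi>\<^sup>2) * exp (- \<xi>\<^sup>2 / 2))"
    unfolding 2 1 by (simp add: algebra_simps power2_eq_square)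
  then show ?thesis
    using I[of "1/2" 2] int[of "1/2" 2] by (simp add: has_bochner_integral_iff field_simps)
qed

lemma normal_density_scale: "0 < \<sigma> \<Longrightarrow> \<sigma> * normal_density 0 \<sigma> (\<sigma> * x) = std_normal_density x"
  by (simp add: normal_density_def real_sqrt_mult field_simps)

text \<open>With variance \<open>2 * s\<close> the transform is exp (- s \<xi>^2), so
  \<open>s\<close> plays the role of heat time. The weight x^2 / (4 s) in the second formula is the
  negative exponent of the density, which is what differentiation in a parameter brings
  down.\<close>

lemma gaussian_wave_integral:
  assumes "0 < s"
  shows "has_bochner_integral lborel
      (\<lambda>x. of_real (normal_density 0 (sqrt (2 * s)) x) * cis (- (\<xi> * x)))
      (of_real (exp (- s * \<xi>\<^sup>2)))" (is ?th1)
    and "has_bochner_integral lborel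
      (\<lambda>x. of_real (x\<^sup>2 / (4 * s) * normal_density 0 (sqrt (2 * s)) x) * cis (- (\<xi> * x)))
      (of_real ((1 / 2 - s * \<xi>\<^sup>2) * exp (- s * \<xi>\<^sup>2)))" (is ?th2)
proof -
  define \<sigma> where "\<sigma> = sqrt (2 * s)"
  have \<sigma>: "0 < \<sigma>" "s = \<sigma>\<^sup>2 / 2" using assms by (auto simp: \<sigma>_def)
  have wave: "std_wave (\<xi> * \<sigma>) x = \<sigma> *\<^sub>R (of_real (normal_density 0 \<sigma> (\<sigma> * x)) * cis (- (\<xi> * (\<sigma> * x))))" for x
    unfolding std_wave_def normal_density_scale[OF \<sigma>(1), symmetric]
    by (simp add: scaleR_conv_of_real mult.assoc)
  have exp: "- (\<xi> * \<sigma>)\<^sup>2 / 2 = - s * \<xi>\<^sup>2"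
    unfolding \<sigma>(2) by (simp add: power_mult_distrib)
  have th1: "has_bochner_integral lborel
      (\<lambda>x. of_real (normal_density 0 \<sigma> x) * cis (- (\<xi> * x))) (of_real (exp (- s * \<xi>\<^sup>2)))"
  proof (rule has_bochner_integral_scale_real[OF _ \<sigma>(1)])
    show "has_bochner_integral lborel
      (\<lambda>x. \<sigma> *\<^sub>R (of_real (normal_density 0 \<sigma> (\<sigma> * x)) * cis (- (\<xi> * (\<sigma> * x)))))
      (of_real (exp (- s * \<xi>\<^sup>2)))"
      using std_wave_integral[of "\<xi> * \<sigma>"] unfolding wave[abs_def] exp .
  qed
  have wave2: "of_real (x\<^sup>2 / 2) * std_wave (\<xi> * \<sigma>) x = \<sigma> *\<^sub>R (of_real ((\<sigma> * x)\<^sup>2 / (4 * s) *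
      normal_density 0 \<sigma> (\<sigma> * x)) * cis (- (\<xi> * (\<sigma> * x))))" for x
  proof -
    have *: "(\<sigma> * x)\<^sup>2 / (4 * s) = x\<^sup>2 / 2"
      unfolding \<sigma>(2) using \<sigma>(1) by (simp add: power_mult_distrib)
    show ?thesis
      unfolding wave * by (simp add: scaleR_conv_of_real)
  qed
  have exp2: "1 / 2 - (\<xi> * \<sigma>)\<^sup>2 / 2 = 1 / 2 - s * \<xi>\<^sup>2"
    using exp by linarith
  have th2: "has_bochner_integral lborel
      (\<lambda>x. of_real (x\<^sup>2 / (4 * s) * normal_density 0 \<sigma> x) * cis (- (\<xi> * x)))
      (of_real ((1 / 2 - s * \<xi>\<^sup>2) * exp (- s * \<xi>\<^sup>2)))"
  proof (rule has_bochner_integral_scale_real[OF _ \<sigma>(1)])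
    show "has_bochner_integral lborel (\<lambda>x. \<sigma> *\<^sub>R (of_real ((\<sigma> * x)\<^sup>2 / (4 * s) *
        normal_density 0 \<sigma> (\<sigma> * x)) * cis (- (\<xi> * (\<sigma> * x)))))
      (of_real ((1 / 2 - s * \<xi>\<^sup>2) * exp (- s * \<xi>\<^sup>2)))"
      using std_wave_second_moment[of "\<xi> * \<sigma>"] unfolding wave2[abs_def] exp exp2 .
  qed
  show ?th1 ?th2
    using th1 th2 by (simp_all only: \<sigma>_def)
qed

section \<open>Gaussians on Euclidean spaces as products over coordinates\<close>

text \<open>Fubini for product integrands: \<open>lborel\<close> on a Euclidean space is the image
  of the product of one-dimensional Lebesgue measures indexed by \<open>Basis\<close>.\<close>

lemma has_bochner_integral_prod_Basis:
  fixes f :: "'a::euclidean_space \<Rightarrow> real \<Rightarrow> 'b::{real_normed_field, banach, second_countable_topology}"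
  assumes "\<And>b. b \<in> Basis \<Longrightarrow> has_bochner_integral lborel (f b) (I b)"
  shows "has_bochner_integral lborel (\<lambda>z::'a. \<Prod>b\<in>Basis. f b (z \<bullet> b)) (\<Prod>b\<in>Basis. I b)"
proof -
  interpret product_sigma_finite "\<lambda>_::'a. lborel :: real measure" ..
  have f: "\<And>b. b \<in> Basis \<Longrightarrow> integrable lborel (f b)"
    using assms by (auto simp: has_bochner_integral_iff)
  have [measurable]: "\<And>b. b \<in> Basis \<Longrightarrow> f b \<in> borel_measurable borel"
    using borel_measurable_integrable[OF f] by simp
  have [simp]: "(\<Sum>b\<in>Basis. x b *\<^sub>R b) \<bullet> c = x c" if "c \<in> Basis" for x and c :: 'a
    using that by (simp add: inner_sum_left inner_Basis if_distrib cong: if_cong)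
  show ?thesis
    unfolding lborel_def[where 'a = 'a] lborel_eq_real[symmetric]
    by (subst has_bochner_integral_distr)
      (use product_integrable_prod[of Basis f] product_integral_prod[of Basis f] f assms in
        \<open>auto simp: has_bochner_integral_iff\<close>)
qed


definition gauss_density :: "('a::euclidean_space \<Rightarrow> real) \<Rightarrow> 'a \<Rightarrow> real" where
  "gauss_density s z = (\<Prod>b\<in>Basis. normal_density 0 (sqrt (2 * s b)) (z \<bullet> b))"

lemma cis_sum: "finite A \<Longrightarrow> cis (sum f A) = (\<Prod>a\<in>A. cis (f a))"
  by (induction rule: finite_induct) (auto simp: cis_mult[symmetric])

lemma cis_inner: "cis (- (\<xi> \<bullet> z)) = (\<Prod>b\<in>Basis. cis (- ((\<xi> \<bullet> b) * (z \<bullet> b))))"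
  by (subst euclidean_inner) (simp add: cis_sum flip: sum_negf)

lemma gauss_wave_integral:
  fixes s :: "'a::euclidean_space \<Rightarrow> real"
  assumes "\<And>b. b \<in> Basis \<Longrightarrow> 0 < s b"
  shows "has_bochner_integral lborel (\<lambda>z. of_real (gauss_density s z) * cis (- (\<xi> \<bullet> z)))
    (of_real (exp (- (\<Sum>b\<in>Basis. s b * (\<xi> \<bullet> b)\<^sup>2))))"
proof -
  have "has_bochner_integral lborel
      (\<lambda>z. \<Prod>b\<in>Basis. of_real (normal_density 0 (sqrt (2 * s b)) (z \<bullet> b)) * cis (- ((\<xi> \<bullet> b) * (z \<bullet> b))))
      (\<Prod>b\<in>Basis. complex_of_real (exp (- s b * (\<xi> \<bullet> b)\<^sup>2)))"
    using assms by (intro has_bochner_integral_prod_Basis gaussian_wave_integral)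
  then show ?thesis
    by (simp add: gauss_density_def cis_inner prod.distrib exp_sum flip: sum_negf)
qed

text \<open>The exponent is a sum over coordinates \<open>c\<close>, and each summand times the
  density is again a product in which only the factor at \<open>c\<close> is altered;
  \<open>g\<close> and \<open>h\<close> record this alteration before and after integration. The
  constants 1/2 add up to half the dimension.\<close>

lemma gauss_second_moment_wave:
  fixes s :: "'a::euclidean_space \<Rightarrow> real"
  assumes s: "\<And>b. b \<in> Basis \<Longrightarrow> 0 < s b"
  shows "has_bochner_integral lborel
    (\<lambda>z. of_real ((\<Sum>b\<in>Basis. (z \<bullet> b)\<^sup>2 / (4 * s b)) * gauss_density s z) * cis (- (\<xi> \<bullet> z)))
    (of_real ((real DIM('a) / 2 - (\<Sum>b\<in>Basis. s b * (\<xi> \<bullet> b)\<^sup>2)) *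
      exp (- (\<Sum>b\<in>Basis. s b * (\<xi> \<bullet> b)\<^sup>2))))"
proof -
  define g where "g b c x = (if b = c then x\<^sup>2 / (4 * s b) else 1)" for b c :: 'a and x
  define h where "h b c = (if b = c then 1 / 2 - s b * (\<xi> \<bullet> b)\<^sup>2 else 1)" for b c :: 'a
  have g: "(\<Prod>b\<in>Basis. g b c (z \<bullet> b)) = (z \<bullet> c)\<^sup>2 / (4 * s c)" if "c \<in> Basis" for c and z :: 'a
    using that by (simp add: g_def)
  have h: "(\<Prod>b\<in>Basis. h b c) = 1 / 2 - s c * (\<xi> \<bullet> c)\<^sup>2" if "c \<in> Basis" for c
    using that by (simp add: h_def)
  have e: "(\<Prod>b\<in>Basis. exp (- s b * (\<xi> \<bullet> b)\<^sup>2)) = exp (- (\<Sum>b\<in>Basis. s b * (\<xi> \<bullet> b)\<^sup>2))"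
    by (simp add: exp_sum flip: sum_negf)
  have "has_bochner_integral lborel
      (\<lambda>z. \<Sum>c\<in>Basis. \<Prod>b\<in>Basis. of_real (g b c (z \<bullet> b) * normal_density 0 (sqrt (2 * s b)) (z \<bullet> b)) *
        cis (- ((\<xi> \<bullet> b) * (z \<bullet> b))))
      (\<Sum>c\<in>Basis. \<Prod>b\<in>Basis. complex_of_real (h b c * exp (- s b * (\<xi> \<bullet> b)\<^sup>2)))"
    using gaussian_wave_integral[OF s]
    by (intro has_bochner_integral_sum has_bochner_integral_prod_Basis) (auto simp: g_def h_def)
  also have "(\<lambda>z. \<Sum>c\<in>Basis. \<Prod>b\<in>Basis. of_real (g b c (z \<bullet> b) * normal_density 0 (sqrt (2 * s b)) (z \<bullet> b)) *
        cis (- ((\<xi> \<bullet> b) * (z \<bullet> b)))) =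
    (\<lambda>z. of_real ((\<Sum>b\<in>Basis. (z \<bullet> b)\<^sup>2 / (4 * s b)) * gauss_density s z) * cis (- (\<xi> \<bullet> z)))"
    by (simp only: of_real_mult prod.distrib gauss_density_def cis_inner of_real_prod[symmetric] g
      of_real_sum sum_distrib_right cong: sum.cong)
  also have "(\<Sum>c\<in>Basis. \<Prod>b\<in>Basis. complex_of_real (h b c * exp (- s b * (\<xi> \<bullet> b)\<^sup>2))) =
    of_real ((real DIM('a) / 2 - (\<Sum>b\<in>Basis. s b * (\<xi> \<bullet> b)\<^sup>2)) *
      exp (- (\<Sum>b\<in>Basis. s b * (\<xi> \<bullet> b)\<^sup>2)))"
    by (simp only: of_real_mult prod.distrib of_real_prod[symmetric] h of_real_sum[symmetric] of_real_eq_iff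
      sum_distrib_right[symmetric] e h sum_subtractf cong: sum.cong) simp
  finally show ?thesis .
qed

section \<open>Oscillatory integrals and \<open>L\<^sup>1\<close> multipliers\<close>

text \<open>The inverse Fourier transform without its constant. Dropping the constant here and in
  \<open>L1_multiplier\<close> makes multipliers act by exact convolution.\<close>

definition osc_integral :: "('a::euclidean_space \<Rightarrow> complex) \<Rightarrow> 'a \<Rightarrow> complex" where
  "osc_integral \<phi> z = (LINT \<xi>|lborel. cis (\<xi> \<bullet> z) * \<phi> \<xi>)"

lemma osc_integral_measurable:
  fixes \<phi> :: "'a::euclidean_space \<Rightarrow> complex"
  assumes [measurable]: "\<phi> \<in> borel_measurable borel"
  shows "osc_integral \<phi> \<in> borel_measurable borel"
  unfolding osc_integral_def[abs_def]
  by (rule lborel.borel_measurable_lebesgue_integral) (simp add: case_prod_unfold)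

lemma norm_osc_integral_le: "norm (osc_integral \<phi> z) \<le> (LINT \<xi>|lborel. norm (\<phi> \<xi>))"
  unfolding osc_integral_def
  by (rule order_trans[OF integral_norm_bound]) (simp add: norm_mult)

lemma nn_integral_lborel_translate:
  fixes f :: "'a::euclidean_space \<Rightarrow> ennreal"
  assumes [measurable]: "f \<in> borel_measurable borel"
  shows "(\<integral>\<^sup>+z. f (a + z) \<partial>lborel) = (\<integral>\<^sup>+z. f z \<partial>lborel)"
  by (subst (2) lborel_distr_plus[of a, symmetric]) (simp add: nn_integral_distr)

text \<open>Both endpoints of the later interpolation are tracked on the transform side:
  \<open>S\<close> for p = \<infinity> and \<open>L\<close> for p = 1.\<close>

definition osc_bounds :: "('a::euclidean_space \<Rightarrow> complex) \<Rightarrow> real \<Rightarrow> real \<Rightarrow> bool" where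
  "osc_bounds \<phi> S L \<longleftrightarrow> integrable lborel \<phi> \<and> (\<forall>z. norm (osc_integral \<phi> z) \<le> S) \<and>
     (\<integral>\<^sup>+z. ennreal (norm (osc_integral \<phi> z)) \<partial>lborel) \<le> ennreal L"

text \<open>Multipliers are described through a real convolution kernel \<open>w\<close>, because a
  bound on its L^1 norm can be uniform even where derivatives of \<open>M\<close> are not.\<close>

definition L1_multiplier :: "('a::euclidean_space \<Rightarrow> complex) \<Rightarrow> real \<Rightarrow> bool" where
  "L1_multiplier M K \<longleftrightarrow> (\<exists>w::'a \<Rightarrow> real. integrable lborel w \<and> (LINT y|lborel. \<bar>w y\<bar>) \<le> K \<and>
     (\<forall>\<xi>. M \<xi> = (LINT y|lborel. cis (- (\<xi> \<bullet> y)) * of_real (w y))))"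

text \<open>Young's inequality at the two endpoints: multiplication by \<open>M\<close> becomes
  convolution with \<open>w\<close> on the transform side, which costs at most the L^1 norm of
  \<open>w\<close> in either bound.\<close>

lemma osc_bounds_multiplier:
  fixes \<phi> :: "'a::euclidean_space \<Rightarrow> complex"
  assumes M: "L1_multiplier M K" and \<phi>: "osc_bounds \<phi> S L"
  shows "osc_bounds (\<lambda>\<xi>. M \<xi> * \<phi> \<xi>) (K * S) (K * L)"
proof -
  from M obtain w :: "'a \<Rightarrow> real" where w: "integrable lborel w" and K: "(LINT y|lborel. \<bar>w y\<bar>) \<le> K"
    and M: "\<And>\<xi>. M \<xi> = (LINT y|lborel. cis (- (\<xi> \<bullet> y)) * of_real (w y))"
    unfolding L1_multiplier_def by blast
  have S: "\<And>z. norm (osc_integral \<phi> z) \<le> S"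
    and L: "(\<integral>\<^sup>+z. ennreal (norm (osc_integral \<phi> z)) \<partial>lborel) \<le> ennreal L"
    and int: "integrable lborel \<phi>"
    using \<phi> by (auto simp: osc_bounds_def)
  have [measurable]: "w \<in> borel_measurable borel" "\<phi> \<in> borel_measurable borel"
    using w int by auto
  have [measurable]: "osc_integral \<phi> \<in> borel_measurable borel"
    by (rule osc_integral_measurable) measurable
  have K0: "0 \<le> K" using K by (rule order_trans[OF Bochner_Integration.integral_nonneg, rotated]) auto
  have S0: "0 \<le> S" using S[of 0] norm_ge_zero order_trans by blast
  have [measurable]: "M \<in> borel_measurable borel"
    unfolding M[abs_def] by (rule lborel.borel_measurable_lebesgue_integral) (simp add: case_prod_unfold)
  have Mle: "norm (M \<xi>) \<le> K" for \<xi>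
    unfolding M by (rule order_trans[OF integral_norm_bound]) (use K in \<open>simp add: norm_mult\<close>)
  have intM: "integrable lborel (\<lambda>\<xi>. M \<xi> * \<phi> \<xi>)"
    by (rule Bochner_Integration.integrable_bound[of _ "\<lambda>\<xi>. K * norm (\<phi> \<xi>)"])
      (use int Mle K0 in \<open>auto simp: norm_mult intro!: mult_right_mono\<close>)
  \<comment> \<open>Fubini applies because the double integrand has modulus |w(y)|
    |\<phi>(\<xi>)|.\<close>
  have conv: "osc_integral (\<lambda>\<xi>. M \<xi> * \<phi> \<xi>) z = (LINT y|lborel. of_real (w y) * osc_integral \<phi> (z - y))" for z
  proof -
    have cis: "cis (\<xi> \<bullet> (z - y)) = cis (\<xi> \<bullet> z) * cis (- (\<xi> \<bullet> y))" for \<xi> y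
      by (simp add: cis_mult inner_diff_right)
    have iw: "integrable lborel (\<lambda>y. cis (\<xi> \<bullet> (z - y)) * (of_real (w y) * \<phi> \<xi>))" for \<xi>
      using w by (intro integrable_cis_mult integrable_mult_left integrable_of_real) auto
    have inner: "(LINT \<xi>|lborel. cis (\<xi> \<bullet> (z - y)) * (of_real (w y) * \<phi> \<xi>)) =
        of_real (w y) * osc_integral \<phi> (z - y)" for y
      unfolding osc_integral_def by (simp add: mult.left_commute[of _ "of_real (w y)"])
    have "integrable (lborel \<Otimes>\<^sub>M lborel) (\<lambda>p. cis (fst p \<bullet> (z - snd p)) * (of_real (w (snd p)) * \<phi> (fst p)))"
    proof (rule lborel_pair.Fubini_integrable)
      show "integrable lborel (\<lambda>x. LINT y|lborel. norm (cis (fst (x, y) \<bullet> (z - snd (x, y))) *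
        (of_real (w (snd (x, y))) * \<phi> (fst (x, y)))))"
        using int by (simp add: norm_mult)
    qed (use iw in simp_all)
    then have "(LINT y|lborel. LINT \<xi>|lborel. cis (\<xi> \<bullet> (z - y)) * (of_real (w y) * \<phi> \<xi>)) =
      (LINT \<xi>|lborel. LINT y|lborel. cis (\<xi> \<bullet> (z - y)) * (of_real (w y) * \<phi> \<xi>))"
      by (intro lborel_pair.Fubini_integral) (simp add: case_prod_unfold)
    also have "(LINT \<xi>|lborel. LINT y|lborel. cis (\<xi> \<bullet> (z - y)) * (of_real (w y) * \<phi> \<xi>)) =
      osc_integral (\<lambda>\<xi>. M \<xi> * \<phi> \<xi>) z"
      unfolding osc_integral_def
    proof (rule Bochner_Integration.integral_cong[OF refl])
      fix \<xi> :: 'a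
      have "(LINT y|lborel. cis (\<xi> \<bullet> (z - y)) * (of_real (w y) * \<phi> \<xi>)) =
        (LINT y|lborel. (cis (\<xi> \<bullet> z) * \<phi> \<xi>) * (cis (- (\<xi> \<bullet> y)) * of_real (w y)))"
        by (simp add: cis mult_ac)
      also have "\<dots> = (cis (\<xi> \<bullet> z) * \<phi> \<xi>) * M \<xi>"
        unfolding M by (rule integral_mult_right_zero)
      finally show "(LINT y|lborel. cis (\<xi> \<bullet> (z - y)) * (of_real (w y) * \<phi> \<xi>)) = cis (\<xi> \<bullet> z) * (M \<xi> * \<phi> \<xi>)"
        by (simp add: mult_ac)
    qed
    finally show ?thesis unfolding inner by simp
  qed
  have "norm (osc_integral (\<lambda>\<xi>. M \<xi> * \<phi> \<xi>) z) \<le> K * S" for z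
  proof -
    have "norm (osc_integral (\<lambda>\<xi>. M \<xi> * \<phi> \<xi>) z) \<le> (LINT y|lborel. norm (of_real (w y) * osc_integral \<phi> (z - y)))"
      unfolding conv by (rule integral_norm_bound)
    also have "\<dots> \<le> (LINT y|lborel. \<bar>w y\<bar> * S)"
    proof (rule integral_mono)
      show "integrable lborel (\<lambda>y. norm (of_real (w y) * osc_integral \<phi> (z - y)))"
        by (rule Bochner_Integration.integrable_bound[of _ "\<lambda>y. \<bar>w y\<bar> * S"])
          (use w S S0 in \<open>auto simp: norm_mult intro!: mult_left_mono\<close>)
    qed (use w S in \<open>auto simp: norm_mult intro!: mult_left_mono\<close>)
    also have "\<dots> \<le> K * S"
      using K S0 by (auto intro!: mult_right_mono)
    finally show ?thesis .
  qed
  moreover have "(\<integral>\<^sup>+z. ennreal (norm (osc_integral (\<lambda>\<xi>. M \<xi> * \<phi> \<xi>) z)) \<partial>lborel) \<le> ennreal (K * L)"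
  proof -
    have "(\<integral>\<^sup>+z. ennreal (norm (osc_integral (\<lambda>\<xi>. M \<xi> * \<phi> \<xi>) z)) \<partial>lborel) \<le>
      (\<integral>\<^sup>+z. \<integral>\<^sup>+y. ennreal \<bar>w y\<bar> * ennreal (norm (osc_integral \<phi> (z - y))) \<partial>lborel \<partial>lborel)"
    proof (rule nn_integral_mono)
      fix z :: 'a
      have "integrable lborel (\<lambda>y. of_real (w y) * osc_integral \<phi> (z - y))"
        by (rule Bochner_Integration.integrable_bound[of _ "\<lambda>y. \<bar>w y\<bar> * S"])
          (use w S S0 in \<open>auto simp: norm_mult intro!: mult_left_mono\<close>)
      from integral_norm_bound_ennreal[OF this]
      show "ennreal (norm (osc_integral (\<lambda>\<xi>. M \<xi> * \<phi> \<xi>) z)) \<le>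
        (\<integral>\<^sup>+y. ennreal \<bar>w y\<bar> * ennreal (norm (osc_integral \<phi> (z - y))) \<partial>lborel)"
        unfolding conv by (simp add: norm_mult ennreal_mult)
    qed
    also have "\<dots> = (\<integral>\<^sup>+y. \<integral>\<^sup>+z. ennreal \<bar>w y\<bar> * ennreal (norm (osc_integral \<phi> (z - y))) \<partial>lborel \<partial>lborel)"
      by (rule lborel_pair.Fubini') (simp add: case_prod_unfold)
    also have "\<dots> = (\<integral>\<^sup>+y. ennreal \<bar>w y\<bar> * (\<integral>\<^sup>+z. ennreal (norm (osc_integral \<phi> z)) \<partial>lborel) \<partial>lborel)"
      using nn_integral_lborel_translate[of "\<lambda>z. ennreal (norm (osc_integral \<phi> z))" "- y" for y]
      by (simp add: nn_integral_cmult)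
    also have "\<dots> = (\<integral>\<^sup>+y. ennreal \<bar>w y\<bar> \<partial>lborel) * (\<integral>\<^sup>+z. ennreal (norm (osc_integral \<phi> z)) \<partial>lborel)"
      by (simp add: nn_integral_multc)
    also have "(\<integral>\<^sup>+y. ennreal \<bar>w y\<bar> \<partial>lborel) = ennreal (LINT y|lborel. \<bar>w y\<bar>)"
      using w by (intro nn_integral_eq_integral) auto
    also have "\<dots> * (\<integral>\<^sup>+z. ennreal (norm (osc_integral \<phi> z)) \<partial>lborel) \<le> ennreal K * ennreal L"
      using K L by (intro mult_mono) (auto intro: ennreal_leI)
    also have "\<dots> = ennreal (K * L)"
      using K0 by (simp add: ennreal_mult')
    finally show ?thesis .
  qed
  ultimately show ?thesis
    using intM by (simp add: osc_bounds_def)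
qed

lemma osc_bounds_multiplier_power:
  assumes "L1_multiplier M K" "osc_bounds \<phi> S L"
  shows "osc_bounds (\<lambda>\<xi>. M \<xi> ^ N * \<phi> \<xi>) (K ^ N * S) (K ^ N * L)"
proof (induction N)
  case (Suc N)
  from osc_bounds_multiplier[OF assms(1) Suc] show ?case
    by (simp add: mult_ac)
qed (use assms in simp)

lemma osc_integral_cmult: "osc_integral (\<lambda>\<xi>. c * \<phi> \<xi>) z = c * osc_integral \<phi> z"
  unfolding osc_integral_def by (simp add: mult.left_commute[of _ c])

lemma osc_bounds_cmult:
  assumes "osc_bounds \<phi> S L"
  shows "osc_bounds (\<lambda>\<xi>. c * \<phi> \<xi>) (norm c * S) (norm c * L)"
proof -
  have [measurable]: "\<phi> \<in> borel_measurable borel"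
    using assms by (auto simp: osc_bounds_def)
  have [measurable]: "osc_integral \<phi> \<in> borel_measurable borel"
    by (rule osc_integral_measurable) measurable
  show ?thesis
    using assms unfolding osc_bounds_def osc_integral_cmult
    by (auto simp: norm_mult ennreal_mult' nn_integral_cmult intro!: mult_left_mono)
qed

section \<open>Sheared Gaussians on phase space\<close>

text \<open>With the second component integrated last, the shear is for each fixed v a translation
  in the first component.\<close>

lemma lborel_distr_shear:
  "distr lborel borel (\<lambda>z::'a::euclidean_space \<times> 'a. (fst z + c *\<^sub>R snd z, snd z)) = lborel"
proof (rule measure_eqI)
  fix A :: "('a \<times> 'a) set"
  assume "A \<in> sets (distr lborel borel (\<lambda>z::'a \<times> 'a. (fst z + c *\<^sub>R snd z, snd z)))"
  then have [measurable]: "A \<in> sets borel" by simp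
  have [measurable]: "(\<lambda>z::'a \<times> 'a. (fst z + c *\<^sub>R snd z, snd z)) \<in> borel_measurable borel"
    by (intro borel_measurable_continuous_onI continuous_intros)
  have "emeasure (distr lborel borel (\<lambda>z. (fst z + c *\<^sub>R snd z, snd z))) A =
    (\<integral>\<^sup>+z. indicator A (fst z + c *\<^sub>R snd z, snd z) \<partial>lborel)"
    by (subst nn_integral_indicator[symmetric], simp, subst nn_integral_distr) (auto intro!: nn_integral_cong)
  also have "\<dots> = (\<integral>\<^sup>+v. \<integral>\<^sup>+x. indicator A (x + c *\<^sub>R v, v) \<partial>lborel \<partial>lborel)"
    unfolding lborel_prod[symmetric] by (subst lborel_pair.nn_integral_snd[symmetric]) (simp_all add: lborel_prod)
  also have "\<dots> = (\<integral>\<^sup>+v. \<integral>\<^sup>+x. indicator A (x, v) \<partial>lborel \<partial>lborel)"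
    using nn_integral_lborel_translate[of "\<lambda>x. indicator A (x, v)" "c *\<^sub>R v" for v]
    by (simp add: add.commute)
  also have "\<dots> = (\<integral>\<^sup>+z. indicator A z \<partial>lborel)"
    unfolding lborel_prod[symmetric] by (subst lborel_pair.nn_integral_snd[symmetric]) (simp_all add: lborel_prod)
  finally show "emeasure (distr lborel borel (\<lambda>z. (fst z + c *\<^sub>R snd z, snd z))) A = emeasure lborel A"
    by simp
qed simp

lemma has_bochner_integral_shear:
  fixes f :: "'a::euclidean_space \<times> 'a \<Rightarrow> 'b::{banach, second_countable_topology}"
  assumes "has_bochner_integral lborel f I"
  shows "has_bochner_integral lborel (\<lambda>z. f (fst z + c *\<^sub>R snd z, snd z)) I"
proof -
  have [measurable]: "(\<lambda>z::'a \<times> 'a. (fst z + c *\<^sub>R snd z, snd z)) \<in> borel_measurable borel"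
    by (intro borel_measurable_continuous_onI continuous_intros)
  have [measurable]: "f \<in> borel_measurable borel"
    using assms by (auto simp: has_bochner_integral_iff)
  have "has_bochner_integral (distr lborel borel (\<lambda>z. (fst z + c *\<^sub>R snd z, snd z))) f I"
    unfolding lborel_distr_shear by fact
  then show ?thesis
    by (simp add: has_bochner_integral_iff integrable_distr_eq integral_distr)
qed

text \<open>For \<alpha> = t m, \<beta> = t^3 m / 12 and c = t / 2 this is m times the integral of
  |s \<xi>1 + \<xi>2|^2 over s from 0 to t, with the square completed in \<xi>2.\<close>

definition sheared_form :: "real \<Rightarrow> real \<Rightarrow> real \<Rightarrow> 'a::euclidean_space \<times> 'a \<Rightarrow> real" where
  "sheared_form \<alpha> \<beta> c = (\<lambda>(\<xi>1, \<xi>2). \<alpha> * (norm (\<xi>2 + c *\<^sub>R \<xi>1))\<^sup>2 + \<beta> * (norm \<xi>1)\<^sup>2)"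

text \<open>One quarter of the inverse quadratic form of \<open>sheared_form\<close>, that is, the
  negative exponent of the Gaussian whose transform is exp (- \<open>sheared_form\<close>).\<close>

definition sheared_dual :: "real \<Rightarrow> real \<Rightarrow> real \<Rightarrow> 'a::euclidean_space \<times> 'a \<Rightarrow> real" where
  "sheared_dual \<alpha> \<beta> c = (\<lambda>(x, v). (norm (x - c *\<^sub>R v))\<^sup>2 / (4 * \<beta>) + (norm v)\<^sup>2 / (4 * \<alpha>))"

definition sheared_gauss :: "real \<Rightarrow> real \<Rightarrow> real \<Rightarrow> 'a::euclidean_space \<times> 'a \<Rightarrow> real" where
  "sheared_gauss \<alpha> \<beta> c z =
     ((4 * pi * \<alpha>) * (4 * pi * \<beta>)) powr (- real DIM('a) / 2) * exp (- sheared_dual \<alpha> \<beta> c z)"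

text \<open>A weight on the basis of the product space: \<open>fst b = 0\<close> singles out the
  basis vectors of the second component. It gives Gaussian variances here and dilation factors
  later.\<close>

definition pair_weight :: "real \<Rightarrow> real \<Rightarrow> 'a::euclidean_space \<times> 'a \<Rightarrow> real" where
  "pair_weight \<alpha> \<beta> b = (if fst b = 0 then \<alpha> else \<beta>)"

lemma norm_power2_Basis: "(norm (x::'a::euclidean_space))\<^sup>2 = (\<Sum>b\<in>Basis. (x \<bullet> b)\<^sup>2)"
  by (subst power2_norm_eq_inner, subst euclidean_inner) (simp add: power2_eq_square)

lemma sum_Basis_Pair:
  "(\<Sum>b\<in>(Basis :: ('a::euclidean_space \<times> 'b::euclidean_space) set). f b) =
    (\<Sum>i\<in>Basis. f (i, 0)) + (\<Sum>i\<in>Basis. f (0, i))"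
  unfolding Basis_prod_def
  by (subst sum.union_disjoint) (auto simp: sum.reindex inj_on_def)

lemma sum_pair_weight:
  fixes z :: "'a::euclidean_space \<times> 'a"
  shows "(\<Sum>b\<in>Basis. f (pair_weight \<alpha> \<beta> b) * (z \<bullet> b)\<^sup>2) =
    f \<alpha> * (norm (snd z))\<^sup>2 + f \<beta> * (norm (fst z))\<^sup>2"
proof -
  have "(\<Sum>b\<in>Basis. f (pair_weight \<alpha> \<beta> b) * (z \<bullet> b)\<^sup>2) =
    (\<Sum>b\<in>Basis. f \<beta> * (fst z \<bullet> b)\<^sup>2) + (\<Sum>b\<in>Basis. f \<alpha> * (snd z \<bullet> b)\<^sup>2)"
    unfolding sum_Basis_Pair by (intro arg_cong2[of _ _ _ _ "(+)"] sum.cong)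
      (auto simp: pair_weight_def inner_prod_def)
  then show ?thesis
    by (simp add: norm_power2_Basis sum_distrib_left)
qed

lemma prod_pair_weight:
  "(\<Prod>b\<in>(Basis :: ('a::euclidean_space \<times> 'a) set). f (pair_weight \<alpha> \<beta> b)) = f \<beta> ^ DIM('a) * f \<alpha> ^ DIM('a)"
proof -
  have "(\<Prod>b\<in>(\<lambda>u::'a. (u, 0::'a)) ` Basis. f (pair_weight \<alpha> \<beta> b)) = (\<Prod>i\<in>(Basis::'a set). f \<beta>)"
    by (subst prod.reindex) (auto simp: inj_on_def pair_weight_def intro!: prod.cong simp del: prod_constant)
  moreover have "(\<Prod>b\<in>(\<lambda>u::'a. (0::'a, u)) ` Basis. f (pair_weight \<alpha> \<beta> b)) = (\<Prod>i\<in>(Basis::'a set). f \<alpha>)"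
    by (subst prod.reindex) (auto simp: inj_on_def pair_weight_def intro!: prod.cong simp del: prod_constant)
  ultimately show ?thesis
    unfolding Basis_prod_def by (subst prod.union_disjoint) auto
qed

lemma gauss_density_pair:
  fixes z :: "'a::euclidean_space \<times> 'a"
  assumes pos: "0 < \<alpha>" "0 < \<beta>"
  shows "gauss_density (pair_weight \<alpha> \<beta>) z = sheared_gauss \<alpha> \<beta> 0 z"
proof -
  let ?s = "pair_weight \<alpha> \<beta> :: 'a \<times> 'a \<Rightarrow> real"
  have s: "0 < ?s b" for b
    using pos by (simp add: pair_weight_def)
  have "gauss_density ?s z = (\<Prod>b\<in>Basis. (4 * pi * ?s b) powr (- 1 / 2) * exp (- (1 / (4 * ?s b) * (z \<bullet> b)\<^sup>2)))"
    unfolding gauss_density_def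
  proof (rule prod.cong[OF refl])
    fix b :: "'a \<times> 'a"
    show "normal_density 0 (sqrt (2 * ?s b)) (z \<bullet> b) =
      (4 * pi * ?s b) powr (- 1 / 2) * exp (- (1 / (4 * ?s b) * (z \<bullet> b)\<^sup>2))"
      using s[of b] by (simp add: normal_density_def powr_minus powr_half_sqrt field_simps)
  qed
  also have "\<dots> = (\<Prod>b\<in>Basis. (4 * pi * ?s b) powr (- 1 / 2)) *
      exp (- (\<Sum>b\<in>Basis. 1 / (4 * ?s b) * (z \<bullet> b)\<^sup>2))"
    by (simp add: prod.distrib exp_sum flip: sum_negf)
  also have "(\<Sum>b\<in>Basis. 1 / (4 * ?s b) * (z \<bullet> b)\<^sup>2) = sheared_dual \<alpha> \<beta> 0 z"
    using sum_pair_weight[of "\<lambda>s. 1 / (4 * s)" \<alpha> \<beta> z] by (simp add: sheared_dual_def case_prod_unfold)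
  also have "(\<Prod>b\<in>Basis. (4 * pi * ?s b) powr (- 1 / 2)) =
    ((4 * pi * \<beta>) powr (- 1 / 2)) ^ DIM('a) * ((4 * pi * \<alpha>) powr (- 1 / 2)) ^ DIM('a)"
    by (rule prod_pair_weight)
  also have "\<dots> = ((4 * pi * \<alpha>) * (4 * pi * \<beta>)) powr (- real DIM('a) / 2)"
  proof -
    have "(y powr (- 1 / 2)) ^ DIM('a) = y powr (- real DIM('a) / 2)" if "0 < y" for y :: real
      using that by (simp add: powr_realpow[symmetric] powr_powr)
    then show ?thesis
      using pos by (subst powr_mult) simp_all
  qed
  finally show ?thesis
    by (simp add: sheared_gauss_def)
qed

lemma sheared_gauss_shift:
  "sheared_gauss \<alpha> \<beta> c z = sheared_gauss \<alpha> \<beta> 0 (fst z + (- c) *\<^sub>R snd z, snd z)"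
  "sheared_dual \<alpha> \<beta> c z = sheared_dual \<alpha> \<beta> 0 (fst z + (- c) *\<^sub>R snd z, snd z)"
  by (simp_all add: sheared_gauss_def sheared_dual_def case_prod_unfold)

text \<open>The shear of frequencies is the inverse transpose of the shear of points, so the pairing
  is invariant and everything reduces to c = 0.\<close>

lemma sheared_phase:
  "(fst \<xi>, snd \<xi> + c *\<^sub>R fst \<xi>) \<bullet> (fst z + (- c) *\<^sub>R snd z, snd z) = \<xi> \<bullet> z"
  by (simp add: inner_prod_def inner_add_left inner_add_right inner_commute inner_diff_right)

lemma sheared_gauss_fourier:
  fixes \<xi> :: "'a::euclidean_space \<times> 'a"
  assumes "0 < \<alpha>" "0 < \<beta>"
  shows "has_bochner_integral lborel (\<lambda>z. of_real (sheared_gauss \<alpha> \<beta> c z) * cis (- (\<xi> \<bullet> z)))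
      (of_real (exp (- sheared_form \<alpha> \<beta> c \<xi>)))" (is ?th1)
    and "has_bochner_integral lborel
      (\<lambda>z. of_real (sheared_dual \<alpha> \<beta> c z * sheared_gauss \<alpha> \<beta> c z) * cis (- (\<xi> \<bullet> z)))
      (of_real ((real DIM('a) - sheared_form \<alpha> \<beta> c \<xi>) * exp (- sheared_form \<alpha> \<beta> c \<xi>)))" (is ?th2)
proof -
  define \<eta> where "\<eta> = (fst \<xi>, snd \<xi> + c *\<^sub>R fst \<xi>)"
  have s: "0 < pair_weight \<alpha> \<beta> b" for b :: "'a \<times> 'a"
    using assms by (simp add: pair_weight_def)
  have q: "(\<Sum>b\<in>Basis. pair_weight \<alpha> \<beta> b * (\<eta> \<bullet> b)\<^sup>2) = sheared_form \<alpha> \<beta> c \<xi>"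
    using sum_pair_weight[of "\<lambda>s. s" \<alpha> \<beta> \<eta>] by (simp add: sheared_form_def \<eta>_def case_prod_unfold)
  have d: "(\<Sum>b\<in>Basis. (z \<bullet> b)\<^sup>2 / (4 * pair_weight \<alpha> \<beta> b)) = sheared_dual \<alpha> \<beta> 0 z" for z :: "'a \<times> 'a"
    using sum_pair_weight[of "\<lambda>s. 1 / (4 * s)" \<alpha> \<beta> z] by (simp add: sheared_dual_def case_prod_unfold)
  have D: "real DIM('a \<times> 'a) / 2 = real DIM('a)"
    by simp
  show ?th1
    using has_bochner_integral_shear[OF gauss_wave_integral[of "pair_weight \<alpha> \<beta>" \<eta>, OF s], of "- c"]
    unfolding q gauss_density_pair[OF assms] sheared_gauss_shift(1)[symmetric]
    by (simp only: \<eta>_def sheared_phase)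
  show ?th2
    using has_bochner_integral_shear[OF gauss_second_moment_wave[of "pair_weight \<alpha> \<beta>" \<eta>, OF s], of "- c"]
    unfolding q d gauss_density_pair[OF assms] sheared_gauss_shift[symmetric] D
    by (simp only: \<eta>_def sheared_phase)
qed

lemma sheared_gauss_integral:
  assumes "0 < \<alpha>" "0 < \<beta>"
  shows "has_bochner_integral lborel (sheared_gauss \<alpha> \<beta> c :: 'a::euclidean_space \<times> 'a \<Rightarrow> real) 1"
    and "has_bochner_integral lborel
      (\<lambda>z::'a \<times> 'a. sheared_dual \<alpha> \<beta> c z * sheared_gauss \<alpha> \<beta> c z) (real DIM('a))"
  using sheared_gauss_fourier[OF assms, where 'a = 'a and c = c and \<xi> = 0, THEN has_bochner_integral_Re]
  by (simp_all add: sheared_form_def case_prod_unfold)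

lemma sheared_gauss_nonneg: "0 \<le> sheared_gauss \<alpha> \<beta> c z"
  by (simp add: sheared_gauss_def)

lemma sheared_dual_nonneg: "0 \<le> \<alpha> \<Longrightarrow> 0 \<le> \<beta> \<Longrightarrow> 0 \<le> sheared_dual \<alpha> \<beta> c z"
  by (simp add: sheared_dual_def case_prod_unfold)

text \<open>The point is that the constants depend on neither \<alpha>, \<beta> nor c. The first
  kernel is a probability density. The second is d g - h with h = \<open>sheared_dual\<close> times
  g, and both d g and h are nonnegative with integral d.\<close>

lemma sheared_gauss_multiplier:
  fixes c :: real
  assumes pos: "0 < \<alpha>" "0 < \<beta>"
  shows "L1_multiplier (\<lambda>\<xi>::'a::euclidean_space \<times> 'a. of_real (exp (- sheared_form \<alpha> \<beta> c \<xi>))) 1" (is ?th1)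
    and "L1_multiplier (\<lambda>\<xi>::'a \<times> 'a. of_real (sheared_form \<alpha> \<beta> c \<xi> * exp (- sheared_form \<alpha> \<beta> c \<xi>)))
      (2 * real DIM('a))" (is ?th2)
proof -
  let ?g = "sheared_gauss \<alpha> \<beta> c :: 'a \<times> 'a \<Rightarrow> real"
  let ?h = "\<lambda>z. sheared_dual \<alpha> \<beta> c z * ?g z"
  note F = sheared_gauss_fourier[OF pos, of c] and G = sheared_gauss_integral[OF pos, of c, where 'a = 'a]
  show ?th1
    unfolding L1_multiplier_def
  proof (intro exI conjI allI)
    show "of_real (exp (- sheared_form \<alpha> \<beta> c \<xi>)) = (LINT y|lborel. cis (- (\<xi> \<bullet> y)) * of_real (?g y))" for \<xi>
      using F(1)[of \<xi>] by (simp add: has_bochner_integral_iff mult.commute)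
  qed (use G(1) in \<open>simp_all add: has_bochner_integral_iff sheared_gauss_nonneg\<close>)
  let ?w = "\<lambda>z. real DIM('a) * ?g z - ?h z"
  have int: "integrable lborel ?g" "integrable lborel ?h"
    using G by (auto simp: has_bochner_integral_iff)
  have "(LINT y|lborel. \<bar>?w y\<bar>) \<le> (LINT y|lborel. real DIM('a) * ?g y + ?h y)"
    using int pos by (intro integral_mono integrable_abs Bochner_Integration.integrable_diff
        Bochner_Integration.integrable_add integrable_mult_right)
      (auto intro!: order_trans[OF abs_triangle_ineq4] simp: abs_mult sheared_gauss_nonneg sheared_dual_nonneg)
  also have "\<dots> = 2 * real DIM('a)"
    using G by (simp add: has_bochner_integral_iff)
  finally have L: "(LINT y|lborel. \<bar>?w y\<bar>) \<le> 2 * real DIM('a)" .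
  have FT: "of_real (sheared_form \<alpha> \<beta> c \<xi> * exp (- sheared_form \<alpha> \<beta> c \<xi>)) =
    (LINT y|lborel. cis (- (\<xi> \<bullet> y)) * of_real (?w y))" for \<xi> :: "'a \<times> 'a"
  proof -
    have "has_bochner_integral lborel (\<lambda>z. of_nat DIM('a) * (of_real (?g z) * cis (- (\<xi> \<bullet> z))))
      (of_nat DIM('a) * of_real (exp (- sheared_form \<alpha> \<beta> c \<xi>)))"
      by (rule has_bochner_integral_mult_right) (rule F(1))
    from has_bochner_integral_diff[OF this F(2)[of \<xi>]]
    show ?thesis
      by (simp add: has_bochner_integral_iff algebra_simps)
  qed
  show ?th2
    unfolding L1_multiplier_def
    by (rule exI[of _ ?w]) (use L FT int in auto)
qed

section \<open>Fourier transforms of test functions\<close>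

lemma times_cont_differentiable_const: "times_cont_differentiable k (\<lambda>_. c)"
  by (induction k arbitrary: c) (simp_all add: frechet_derivative_const)

lemma times_cont_differentiable_lower:
  "times_cont_differentiable (Suc k) f \<Longrightarrow> times_cont_differentiable k f"
proof (induction k arbitrary: f)
  case 0
  then show ?case
    by (auto intro!: continuous_at_imp_continuous_on differentiable_imp_continuous_within)
qed auto

text \<open>Trades \<open>frechet_derivative\<close> for an arbitrary family of derivatives, so that
  closure properties follow by exhibiting the derivative formula.\<close>

lemma times_cont_differentiable_Suc_iff:
  "times_cont_differentiable (Suc k) f \<longleftrightarrow>
    (\<exists>f'. (\<forall>x. (f has_derivative f' x) (at x)) \<and> (\<forall>w. times_cont_differentiable k (\<lambda>x. f' x w)))"
proof
  assume "times_cont_differentiable (Suc k) f"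
  then show "\<exists>f'. (\<forall>x. (f has_derivative f' x) (at x)) \<and> (\<forall>w. times_cont_differentiable k (\<lambda>x. f' x w))"
    by (intro exI[of _ "\<lambda>x. frechet_derivative f (at x)"]) (auto simp: frechet_derivative_works)
next
  assume "\<exists>f'. (\<forall>x. (f has_derivative f' x) (at x)) \<and> (\<forall>w. times_cont_differentiable k (\<lambda>x. f' x w))"
  then obtain f' where f': "\<And>x. (f has_derivative f' x) (at x)" "\<And>w. times_cont_differentiable k (\<lambda>x. f' x w)"
    by blast
  have "frechet_derivative f (at x) = f' x" for x
    using frechet_derivative_at[OF f'(1)] by simp
  then show "times_cont_differentiable (Suc k) f"
    using f' by (auto simp: differentiable_def)
qed

lemma times_cont_differentiable_add:
  "times_cont_differentiable k f \<Longrightarrow> times_cont_differentiable k g \<Longrightarrow>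
    times_cont_differentiable k (\<lambda>x. f x + g x)"
proof (induction k arbitrary: f g)
  case (Suc k)
  then obtain f' g' where "\<And>x. (f has_derivative f' x) (at x)" "\<And>w. times_cont_differentiable k (\<lambda>x. f' x w)"
    "\<And>x. (g has_derivative g' x) (at x)" "\<And>w. times_cont_differentiable k (\<lambda>x. g' x w)"
    unfolding times_cont_differentiable_Suc_iff by blast
  then show ?case
    unfolding times_cont_differentiable_Suc_iff
    by (intro exI[of _ "\<lambda>x w. f' x w + g' x w"]) (auto intro!: has_derivative_add Suc.IH)
qed (auto intro!: continuous_intros)

lemma times_cont_differentiable_mult:
  "times_cont_differentiable k f \<Longrightarrow> times_cont_differentiable k g \<Longrightarrow>
    times_cont_differentiable k (\<lambda>x. f x * g x)"
proof (induction k arbitrary: f g)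
  case (Suc k)
  then obtain f' g' where "\<And>x. (f has_derivative f' x) (at x)" "\<And>w. times_cont_differentiable k (\<lambda>x. f' x w)"
    "\<And>x. (g has_derivative g' x) (at x)" "\<And>w. times_cont_differentiable k (\<lambda>x. g' x w)"
    unfolding times_cont_differentiable_Suc_iff by blast
  then show ?case
    using Suc.prems[THEN times_cont_differentiable_lower]
    unfolding times_cont_differentiable_Suc_iff
    by (intro exI[of _ "\<lambda>x w. f x * g' x w + f' x w * g x"])
      (auto intro!: has_derivative_mult times_cont_differentiable_add Suc.IH)
qed (auto intro!: continuous_intros)

lemma times_cont_differentiable_inverse:
  assumes "\<And>x. f x \<noteq> 0"
  shows "times_cont_differentiable k f \<Longrightarrow> times_cont_differentiable k (\<lambda>x. inverse (f x))"
proof (induction k)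
  case (Suc k)
  then obtain f' where f': "\<And>x. (f has_derivative f' x) (at x)" "\<And>w. times_cont_differentiable k (\<lambda>x. f' x w)"
    unfolding times_cont_differentiable_Suc_iff by blast
  have inv: "times_cont_differentiable k (\<lambda>x. inverse (f x))"
    using Suc times_cont_differentiable_lower by blast
  have "times_cont_differentiable k (\<lambda>x. (- 1) * (inverse (f x) * f' x w * inverse (f x)))" for w
    using f' inv by (intro times_cont_differentiable_mult times_cont_differentiable_const)
  then show ?case
    using f' assms unfolding times_cont_differentiable_Suc_iff
    by (intro exI[of _ "\<lambda>x w. - (inverse (f x) * f' x w * inverse (f x))"])
      (auto intro!: has_derivative_inverse)
qed (use assms in \<open>auto intro!: continuous_intros\<close>)

lemma times_cont_differentiable_linear:
  assumes "bounded_linear h"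
  shows "times_cont_differentiable k f \<Longrightarrow> times_cont_differentiable k (\<lambda>x. f (h x))"
proof (induction k arbitrary: f)
  case 0
  then show ?case
    by (simp add: continuous_on_compose2[of UNIV f UNIV h] linear_continuous_on[OF assms])
next
  case (Suc k)
  then obtain f' where f': "\<And>x. (f has_derivative f' x) (at x)" "\<And>w. times_cont_differentiable k (\<lambda>x. f' x w)"
    unfolding times_cont_differentiable_Suc_iff by blast
  have "((\<lambda>x. f (h x)) has_derivative (\<lambda>w. f' (h x) (h w))) (at x)" for x
    using has_derivative_compose[OF bounded_linear_imp_has_derivative[OF assms] f'(1)] .
  then show ?case
    using Suc.IH[OF f'(2)] unfolding times_cont_differentiable_Suc_iff
    by (intro exI[of _ "\<lambda>x w. f' (h x) (h w)"]) auto
qed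

lemma times_cont_differentiable_inner: "times_cont_differentiable k (\<lambda>x. x \<bullet> a)"
proof (cases k)
  case (Suc n)
  show ?thesis
    unfolding Suc times_cont_differentiable_Suc_iff
    by (intro exI[of _ "\<lambda>x w. w \<bullet> a"])
      (auto intro!: derivative_eq_intros times_cont_differentiable_const)
qed (auto intro!: continuous_intros)

lemma smooth_const: "smooth (\<lambda>_. c)"
  by (simp add: smooth_def times_cont_differentiable_const)

lemma smooth_add: "smooth f \<Longrightarrow> smooth g \<Longrightarrow> smooth (\<lambda>x. f x + g x)"
  by (simp add: smooth_def times_cont_differentiable_add)

lemma smooth_mult: "smooth f \<Longrightarrow> smooth g \<Longrightarrow> smooth (\<lambda>x. f x * g x)"
  by (simp add: smooth_def times_cont_differentiable_mult)

lemma smooth_diff: "smooth f \<Longrightarrow> smooth g \<Longrightarrow> smooth (\<lambda>x. f x - g x)"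
  using smooth_add[of f "\<lambda>x. (- 1) * g x"] smooth_mult[OF smooth_const, of g "- 1"] by simp

lemma smooth_inverse: "smooth f \<Longrightarrow> (\<And>x. f x \<noteq> 0) \<Longrightarrow> smooth (\<lambda>x. inverse (f x))"
  by (simp add: smooth_def times_cont_differentiable_inverse)

lemma smooth_linear: "smooth f \<Longrightarrow> bounded_linear h \<Longrightarrow> smooth (\<lambda>x. f (h x))"
  by (simp add: smooth_def times_cont_differentiable_linear)

lemma smooth_power: "smooth f \<Longrightarrow> smooth (\<lambda>x. f x ^ n)"
  by (induction n) (auto intro: smooth_const smooth_mult)

lemma smooth_sum: "finite A \<Longrightarrow> (\<And>a. a \<in> A \<Longrightarrow> smooth (f a)) \<Longrightarrow> smooth (\<lambda>x. \<Sum>a\<in>A. f a x)"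
  by (induction rule: finite_induct) (auto intro: smooth_const smooth_add)

lemma smooth_norm_power2: "smooth (\<lambda>x::'a::euclidean_space. (norm x)\<^sup>2)"
proof -
  have "(norm x)\<^sup>2 = (\<Sum>b\<in>Basis. (x \<bullet> b) * (x \<bullet> b))" for x :: 'a
    by (subst power2_norm_eq_inner, subst euclidean_inner) simp
  then show ?thesis
    using times_cont_differentiable_inner
    by (auto simp: smooth_def[of "\<lambda>x. x \<bullet> _"] intro!: smooth_sum smooth_mult)
qed

section \<open>Derivatives and decay of transforms of compactly supported functions\<close>

lemma integrable_continuous_bounded_support:
  fixes f :: "'a::euclidean_space \<Rightarrow> 'b::{banach, second_countable_topology}"
  assumes "continuous_on UNIV f" and "\<And>x. R < norm x \<Longrightarrow> f x = 0"
  shows "integrable lborel f"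
proof -
  have "integrable lborel (\<lambda>x. indicator (cball 0 R) x *\<^sub>R f x)"
    by (rule borel_integrable_compact) (use assms(1) in \<open>auto intro: continuous_on_subset\<close>)
  also have "(\<lambda>x. indicator (cball 0 R) x *\<^sub>R f x) = f"
    using assms(2) by (fastforce simp: indicator_def)
  finally show ?thesis .
qed

text \<open>
  By translation invariance the transform of a difference quotient of \<open>f\<close> is a multiple of the
  transform of \<open>f\<close>; dominated convergence then replaces integration by parts.
\<close>

lemma osc_integral_derivative:
  fixes f :: "'a::euclidean_space \<Rightarrow> real"
  assumes f: "\<And>x. (f has_derivative f' x) (at x)" and f': "continuous_on UNIV (\<lambda>x. f' x b)"
    and supp: "\<And>x. R < norm x \<Longrightarrow> f x = 0" "\<And>x. R < norm x \<Longrightarrow> f' x b = 0"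
  shows "osc_integral (\<lambda>x. of_real (f' x b)) z = - \<i> * of_real (z \<bullet> b) * osc_integral (\<lambda>x. of_real (f x)) z"
proof -
  have cont: "continuous_on UNIV f"
    using f by (meson continuous_at_imp_continuous_on has_derivative_continuous)
  have [measurable]: "f \<in> borel_measurable borel"
    using cont by (rule borel_measurable_continuous_onI)
  have line: "((\<lambda>s. f (x + s *\<^sub>R b)) has_real_derivative f' (x + s *\<^sub>R b) b) (at s)" for x s
  proof -
    have "((\<lambda>s. f (x + s *\<^sub>R b)) has_derivative (\<lambda>h. f' (x + s *\<^sub>R b) (h *\<^sub>R b))) (at s)"
      by (rule has_derivative_compose[OF _ f]) (auto intro!: derivative_eq_intros)
    moreover have "f' (x + s *\<^sub>R b) (h *\<^sub>R b) = f' (x + s *\<^sub>R b) b * h" for h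
      using linear_cmul[OF has_derivative_linear[OF f]] by simp
    ultimately show ?thesis by (simp add: has_field_derivative_def mult_commute_abs)
  qed
  have int: "integrable lborel f"
    using cont supp(1) by (rule integrable_continuous_bounded_support)
  have "compact ((\<lambda>x. f' x b) ` cball 0 R)"
    by (intro compact_continuous_image continuous_on_subset[OF f']) auto
  from compact_imp_bounded[OF this]
  obtain B0 where B0: "\<And>x. x \<in> cball 0 R \<Longrightarrow> \<bar>f' x b\<bar> \<le> B0"
    unfolding bounded_iff by (metis imageI real_norm_def)
  \<comment> \<open>The maximum with 0 covers points outside the ball, where the derivative
    vanishes, and the case of an empty ball, where \<open>B0\<close> may be negative.\<close>
  define B where "B = max 0 B0"
  have B: "\<bar>f' x b\<bar> \<le> B" for x
    using B0[of x] supp(2)[of x] by (cases "norm x \<le> R") (auto simp: B_def)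
  have mvt: "\<bar>f (x + h *\<^sub>R b) - f x\<bar> \<le> B * \<bar>h\<bar>" for x h
  proof -
    have "norm ((\<lambda>s. f (x + s *\<^sub>R b)) h - (\<lambda>s. f (x + s *\<^sub>R b)) 0) \<le> B * norm (h - 0)"
      by (rule field_differentiable_bound[of UNIV]) (auto intro!: DERIV_subset[OF line] B)
    then show ?thesis by simp
  qed
  define I where "I = osc_integral (\<lambda>x. of_real (f x)) z"
  define h where "h n = 1 / real (Suc n)" for n
  have h: "h \<longlonglongrightarrow> 0" "0 < h n" "h n \<le> 1" for n
    unfolding h_def using LIMSEQ_Suc[OF lim_1_over_n] by (auto simp: field_simps)
  define q where "q n x = (f (x + h n *\<^sub>R b) - f x) / h n" for n x
  have hI: "(LINT x|lborel. cis (x \<bullet> z) * of_real (f (x + t *\<^sub>R b))) = cis (- (t * (z \<bullet> b))) * I"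
    and hint: "integrable lborel (\<lambda>x. f (x + t *\<^sub>R b))" for t
  proof -
    have eq: "lborel = distr lborel borel ((+) (- t *\<^sub>R b))"
      by (rule lborel_distr_plus[symmetric])
    have "(LINT x|lborel. cis (x \<bullet> z) * complex_of_real (f (x + t *\<^sub>R b))) =
      (LINT x|lborel. cis ((- t *\<^sub>R b + x) \<bullet> z) * complex_of_real (f x))"
      by (subst eq, subst integral_distr) (simp_all add: add.commute)
    also have "\<dots> = (LINT x|lborel. cis (- (t * (z \<bullet> b))) * (cis (x \<bullet> z) * complex_of_real (f x)))"
      by (intro Bochner_Integration.integral_cong)
        (simp_all add: inner_diff_left inner_commute[of b] cis_mult flip: mult.assoc)
    finally show "(LINT x|lborel. cis (x \<bullet> z) * of_real (f (x + t *\<^sub>R b))) = cis (- (t * (z \<bullet> b))) * I"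
      by (simp add: I_def osc_integral_def)
    show "integrable lborel (\<lambda>x. f (x + t *\<^sub>R b))"
      by (subst eq, subst integrable_distr_eq) (use int in \<open>simp_all add: add.commute\<close>)
  qed
  \<comment> \<open>The mean value bound and the steps \<open>h n\<close> of size at most 1 give one
    dominating function for all difference quotients: \<open>B\<close> on the ball enlarged by
    \<open>norm b\<close>.\<close>
  have "(\<lambda>n. LINT x|lborel. cis (x \<bullet> z) * of_real (q n x)) \<longlonglongrightarrow> (LINT x|lborel. cis (x \<bullet> z) * of_real (f' x b))"
  proof (rule integral_dominated_convergence[where w = "\<lambda>x. B * indicator (cball 0 (R + norm b)) x"])
    show "integrable lborel (\<lambda>x. B * indicat_real (cball 0 (R + norm b)) x)"
      using emeasure_lborel_cball_finite[of 0 "R + norm b"]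
      by (intro integrable_mult_right integrable_real_indicator) auto
    have [measurable]: "(\<lambda>x. f' x b) \<in> borel_measurable borel"
      using f' by (rule borel_measurable_continuous_onI)
    show "(\<lambda>x. cis (x \<bullet> z) * complex_of_real (f' x b)) \<in> borel_measurable lborel"
      "\<And>n. (\<lambda>x. cis (x \<bullet> z) * complex_of_real (q n x)) \<in> borel_measurable lborel"
      unfolding q_def by measurable
    have lim: "(\<lambda>n. q n x) \<longlonglongrightarrow> f' x b" for x
    proof -
      have "((\<lambda>t. (f (x + t *\<^sub>R b) - f x) / t) \<longlongrightarrow> f' x b) (at 0)"
        using line[of x 0] by (simp add: DERIV_def)
      moreover have "filterlim h (at 0) sequentially"
        using h(1) h(2) by (auto simp: filterlim_at intro!: always_eventually less_imp_neq[symmetric])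
      ultimately show ?thesis
        unfolding q_def by (rule filterlim_compose)
    qed
    show "AE x in lborel. (\<lambda>n. cis (x \<bullet> z) * complex_of_real (q n x)) \<longlonglongrightarrow> cis (x \<bullet> z) * complex_of_real (f' x b)"
      by (intro always_eventually allI tendsto_intros lim)
    show "AE x in lborel. norm (cis (x \<bullet> z) * complex_of_real (q n x)) \<le> B * indicat_real (cball 0 (R + norm b)) x" for n
    proof (intro always_eventually allI)
      fix x
      have "q n x = 0" if "R + norm b < norm x"
      proof -
        have "norm x \<le> norm (x + h n *\<^sub>R b) + norm (h n *\<^sub>R b)"
          by (metis add_diff_cancel norm_triangle_ineq4)
        moreover have "norm (h n *\<^sub>R b) \<le> norm b"
          using h(2)[of n] h(3)[of n] by (simp add: mult_left_le_one_le)
        ultimately show ?thesis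
          using that supp(1)[of x] supp(1)[of "x + h n *\<^sub>R b"] norm_ge_zero[of b] by (simp add: q_def)
      qed
      moreover have "\<bar>q n x\<bar> \<le> B"
        using mvt[of x "h n"] h(2)[of n] by (simp add: q_def field_simps)
      ultimately show "norm (cis (x \<bullet> z) * complex_of_real (q n x)) \<le> B * indicat_real (cball 0 (R + norm b)) x"
        by (auto simp: norm_mult indicator_def)
    qed
  qed
  moreover have "(LINT x|lborel. cis (x \<bullet> z) * of_real (q n x)) = (cis (- (h n * (z \<bullet> b))) - 1) / of_real (h n) * I" for n
  proof -
    have "(LINT x|lborel. cis (x \<bullet> z) * complex_of_real (q n x)) =
      (LINT x|lborel. (cis (x \<bullet> z) * of_real (f (x + h n *\<^sub>R b)) - cis (x \<bullet> z) * of_real (f x)) / of_real (h n))"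
      by (intro Bochner_Integration.integral_cong) (simp_all add: q_def algebra_simps diff_divide_distrib)
    also have "\<dots> = ((LINT x|lborel. cis (x \<bullet> z) * complex_of_real (f (x + h n *\<^sub>R b))) - I) / of_real (h n)"
      unfolding I_def osc_integral_def using int hint[of "h n"]
      by (subst integral_divide_zero, subst Bochner_Integration.integral_diff) (auto intro!: integrable_cis_mult)
    finally show ?thesis
      unfolding hI by (simp add: algebra_simps diff_divide_distrib)
  qed
  moreover have "(\<lambda>n. (cis (- (h n * (z \<bullet> b))) - 1) / of_real (h n) * I) \<longlonglongrightarrow> - \<i> * of_real (z \<bullet> b) * I"
  proof (rule tendsto_mult_right)
    have "((\<lambda>w. exp (- \<i> * of_real (z \<bullet> b) * w)) has_field_derivative - \<i> * of_real (z \<bullet> b)) (at 0)"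
      by (auto intro!: derivative_eq_intros)
    then have "((\<lambda>w. (exp (- \<i> * of_real (z \<bullet> b) * w) - 1) / w) \<longlongrightarrow> - \<i> * of_real (z \<bullet> b)) (at 0)"
      by (simp add: DERIV_def)
    moreover have "filterlim (\<lambda>n. complex_of_real (h n)) (at 0) sequentially"
      using tendsto_of_real[OF h(1), where 'a = complex] h(2)
      by (auto simp: filterlim_at intro!: always_eventually less_imp_neq[symmetric])
    ultimately have "(\<lambda>n. (exp (- \<i> * of_real (z \<bullet> b) * of_real (h n)) - 1) / of_real (h n))
      \<longlonglongrightarrow> - \<i> * of_real (z \<bullet> b)"
      by (rule filterlim_compose)
    then show "(\<lambda>n. (cis (- (h n * (z \<bullet> b))) - 1) / of_real (h n)) \<longlonglongrightarrow> - \<i> * of_real (z \<bullet> b)"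
      by (simp add: cis_conv_exp mult_ac)
  qed
  ultimately show ?thesis
    unfolding I_def[symmetric] by (simp add: LIMSEQ_unique osc_integral_def[of "\<lambda>x. of_real (f' x b)"])
qed

lemma smooth_directional_derivative:
  "smooth f \<Longrightarrow> smooth (\<lambda>x. frechet_derivative f (at x) b)"
  unfolding smooth_def by (metis times_cont_differentiable.simps(2))

lemma smooth_continuous: "smooth f \<Longrightarrow> continuous_on UNIV f"
  unfolding smooth_def by (metis times_cont_differentiable.simps(1))

lemma smooth_has_derivative: "smooth f \<Longrightarrow> (f has_derivative frechet_derivative f (at x)) (at x)"
  unfolding smooth_def frechet_derivative_works[symmetric]
  by (metis times_cont_differentiable.simps(2))

lemma frechet_derivative_outside_support:
  fixes f :: "'a::euclidean_space \<Rightarrow> real"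
  assumes "\<And>x. R < norm x \<Longrightarrow> f x = 0" "R < norm x"
  shows "frechet_derivative f (at x) = (\<lambda>_. 0)"
proof -
  have "open {x::'a. R < norm x}"
    by (intro open_Collect_less continuous_intros)
  then have "(f has_derivative (\<lambda>_. 0)) (at x)"
    by (rule has_derivative_transform_within_open[OF has_derivative_const[of 0]]) (use assms in auto)
  then show ?thesis
    using frechet_derivative_at by metis
qed

text \<open>Here g is the n-th derivative of f in direction b. Its integrability alone bounds |z .
  b|^n times the transform of f.\<close>

lemma osc_integral_iterated_derivative:
  fixes f :: "'a::euclidean_space \<Rightarrow> real"
  assumes "smooth f" "\<And>x. R < norm x \<Longrightarrow> f x = 0"
  shows "\<exists>g. integrable lborel g \<and>
    (\<forall>z. osc_integral (\<lambda>x. of_real (g x)) z = (- \<i> * of_real (z \<bullet> b)) ^ n * osc_integral (\<lambda>x. of_real (f x)) z)"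
  using assms
proof (induction n arbitrary: f)
  case 0
  then show ?case
    using integrable_continuous_bounded_support[OF smooth_continuous] by (intro exI[of _ f]) auto
next
  case (Suc n)
  let ?f1 = "\<lambda>x. frechet_derivative f (at x) b"
  have f1: "smooth ?f1" "?f1 x = 0" if "R < norm x" for x
    using Suc.prems smooth_directional_derivative frechet_derivative_outside_support[of R f x] that by auto
  have s1: "smooth ?f1"
    using Suc.prems smooth_directional_derivative by auto
  have "osc_integral (\<lambda>x. of_real (?f1 x)) z = - \<i> * of_real (z \<bullet> b) * osc_integral (\<lambda>x. of_real (f x)) z" for z
    using Suc.prems s1 f1
    by (intro osc_integral_derivative[where R = R]) (auto intro: smooth_has_derivative smooth_continuous)
  with Suc.IH[OF s1 f1(2)] show ?case
    by (auto simp: mult_ac)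
qed

text \<open>Replaces a product weight by pure powers of single coordinates, so that derivatives in
  one direction at a time suffice for the decay. The proof bounds each factor by the largest
  one.\<close>

lemma prod_one_plus_le:
  fixes a :: "'a \<Rightarrow> real"
  assumes "finite B" "\<And>b. b \<in> B \<Longrightarrow> 0 \<le> a b"
  shows "(\<Prod>b\<in>B. 1 + a b) \<le> 2 ^ card B * (1 + (\<Sum>b\<in>B. a b ^ card B))"
proof (cases "B = {}")
  case False
  define m where "m = Max (a ` B)"
  have "m \<in> a ` B"
    unfolding m_def using assms(1) False by (intro Max_in) auto
  then obtain b where b: "b \<in> B" "a b = m" by auto
  have "(\<Prod>b\<in>B. 1 + a b) \<le> (\<Prod>b\<in>B. 1 + m)"
    using assms by (intro prod_mono) (auto simp: m_def intro: add_nonneg_nonneg)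
  also have "\<dots> \<le> (2 * max 1 m) ^ card B"
    using assms(2)[OF b(1)] b(2) unfolding prod_constant by (intro power_mono) auto
  also have "\<dots> = 2 ^ card B * max 1 m ^ card B"
    by (rule power_mult_distrib)
  also have "max 1 m ^ card B \<le> 1 + m ^ card B"
    using assms(2)[OF b(1)] b(2) by (auto simp: max_def)
  also have "m ^ card B \<le> (\<Sum>b\<in>B. a b ^ card B)"
    using member_le_sum[of b B "\<lambda>b. a b ^ card B"] b assms by auto
  finally show ?thesis by simp
qed simp

lemma has_bochner_integral_inverse_prod:
  "has_bochner_integral lborel (\<lambda>z::'a::euclidean_space. \<Prod>b\<in>Basis. inverse (1 + (z \<bullet> b)\<^sup>2)) (pi ^ DIM('a))"
proof -
  have "has_bochner_integral lborel (\<lambda>x::real. inverse (1 + x\<^sup>2)) pi"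
    using LBINT_inverse_1_plus_square integrable_inverse_1_plus_square
    by (simp add: has_bochner_integral_iff set_integrable_def interval_lebesgue_integral_def
        set_lebesgue_integral_def)
  then have "has_bochner_integral lborel (\<lambda>z::'a. \<Prod>b\<in>Basis. inverse (1 + (z \<bullet> b)\<^sup>2)) (\<Prod>b\<in>(Basis::'a set). pi)"
    by (intro has_bochner_integral_prod_Basis)
  then show ?thesis by simp
qed

text \<open>Taking 2 D derivatives in each basis direction, D being the dimension, bounds the
  transform times the product of all 1 + (z . b)^2. The reciprocal of that product is integrable,
  with integral pi^D.\<close>

lemma smooth_osc_bounds:
  fixes f :: "'a::euclidean_space \<Rightarrow> real"
  assumes f: "smooth f" "\<And>x. R < norm x \<Longrightarrow> f x = 0"
  shows "\<exists>S>0. osc_bounds (\<lambda>x. of_real (f x)) S S"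
proof -
  let ?I = "osc_integral (\<lambda>x. complex_of_real (f x))"
  let ?D = "DIM('a)"
  have int: "integrable lborel f"
    using f by (intro integrable_continuous_bounded_support smooth_continuous)
  have "\<forall>b. \<exists>C\<ge>0. \<forall>z. ((z \<bullet> b)\<^sup>2) ^ ?D * norm (?I z) \<le> C"
  proof
    fix b :: 'a
    obtain g where g: "\<And>z. osc_integral (\<lambda>x. complex_of_real (g x)) z = (- \<i> * of_real (z \<bullet> b)) ^ (2 * ?D) * ?I z"
      using osc_integral_iterated_derivative[OF f, of R b "2 * ?D"] by blast
    have "((z \<bullet> b)\<^sup>2) ^ ?D * norm (?I z) \<le> (LINT x|lborel. \<bar>g x\<bar>)" for z
      using norm_osc_integral_le[of "\<lambda>x. complex_of_real (g x)" z] unfolding g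
      by (simp add: norm_mult norm_power power_mult)
    then show "\<exists>C\<ge>0. \<forall>z. ((z \<bullet> b)\<^sup>2) ^ ?D * norm (?I z) \<le> C"
      by (intro exI[of _ "LINT x|lborel. \<bar>g x\<bar>"]) auto
  qed
  then obtain C where C: "\<And>b. 0 \<le> C b" "\<And>b z. ((z \<bullet> b)\<^sup>2) ^ ?D * norm (?I z) \<le> C b"
    by metis
  define C0 where "C0 = (LINT x|lborel. \<bar>f x\<bar>)"
  have C0: "0 \<le> C0" "\<And>z. norm (?I z) \<le> C0"
    using norm_osc_integral_le[of "\<lambda>x. complex_of_real (f x)"] by (auto simp: C0_def)
  define K where "K = 2 ^ ?D * (C0 + (\<Sum>b\<in>Basis. C b))"
  have K: "0 \<le> K"
    using C(1) C0(1) unfolding K_def by (intro mult_nonneg_nonneg add_nonneg_nonneg sum_nonneg) auto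
  define P where "P z = (\<Prod>b\<in>Basis. 1 + (z \<bullet> b)\<^sup>2)" for z :: 'a
  have P: "0 < P z" for z
    by (auto simp: P_def intro!: prod_pos add_pos_nonneg)
  have le: "norm (?I z) \<le> K * (\<Prod>b\<in>Basis. inverse (1 + (z \<bullet> b)\<^sup>2))" for z
  proof -
    have "P z * norm (?I z) \<le> (2 ^ ?D * (1 + (\<Sum>b\<in>Basis. ((z \<bullet> b)\<^sup>2) ^ ?D))) * norm (?I z)"
      unfolding P_def by (intro mult_right_mono prod_one_plus_le) auto
    also have "\<dots> = 2 ^ ?D * (norm (?I z) + (\<Sum>b\<in>Basis. ((z \<bullet> b)\<^sup>2) ^ ?D * norm (?I z)))"
      by (simp add: algebra_simps sum_distrib_left)
    also have "\<dots> \<le> K"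
      unfolding K_def by (intro mult_left_mono add_mono sum_mono C C0) auto
    finally have "norm (?I z) \<le> K * inverse (P z)"
      using P[of z] by (simp add: field_simps)
    then show ?thesis
      by (simp add: P_def o_def flip: prod_inversef)
  qed
  have "(\<integral>\<^sup>+z. ennreal (norm (?I z)) \<partial>lborel) \<le>
    (\<integral>\<^sup>+z. ennreal (K * (\<Prod>b\<in>(Basis::'a set). inverse (1 + (z \<bullet> b)\<^sup>2))) \<partial>lborel)"
    by (intro nn_integral_mono ennreal_leI le)
  also have "\<dots> = ennreal (K * pi ^ ?D)"
    using has_bochner_integral_inverse_prod[where 'a = 'a] K
    by (subst nn_integral_eq_integral) (auto simp: has_bochner_integral_iff intro!: mult_nonneg_nonneg prod_nonneg)
  finally have L: "(\<integral>\<^sup>+z. ennreal (norm (?I z)) \<partial>lborel) \<le> ennreal (K * pi ^ ?D)" .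
  \<comment> \<open>One constant dominates both bounds; the summand 1 makes it strictly
    positive.\<close>
  define S where "S = 1 + C0 + K * pi ^ ?D"
  have "0 < S" "C0 \<le> S" "K * pi ^ ?D \<le> S"
    using C0(1) K by (auto simp: S_def intro!: add_pos_nonneg)
  then show ?thesis
    unfolding osc_bounds_def using int C0(2) L
    by (intro exI[of _ S]) (auto intro: order_trans ennreal_leI)
qed

section \<open>Blocks and anisotropic dilations\<close>

text \<open>Based on |f|^q <= (sup |f|)^(q-1) |f|. The factor \<sigma> stands for a Jacobian that
  enters the supremum but not the L^1 norm, and \<open>enn2real (1 / p)\<close> is 0 at p =
  \<infinity>, so one exponent covers all cases.\<close>

lemma Lp_norm_interpolation:
  fixes f :: "'a::euclidean_space \<Rightarrow> complex"
  assumes [measurable]: "f \<in> borel_measurable borel"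
    and sup: "\<And>z. norm (f z) \<le> K * \<sigma>" and L1: "(\<integral>\<^sup>+z. ennreal (norm (f z)) \<partial>lborel) \<le> ennreal K"
    and K: "0 \<le> K" and \<sigma>: "0 < \<sigma>" and p: "1 \<le> p"
  shows "Lp_norm p f \<le> ennreal (K * \<sigma> powr (1 - enn2real (1 / p)))"
proof (cases "p = \<infinity>")
  case True
  have "esssup lborel (\<lambda>z. ennreal (norm (f z))) \<le> ennreal (K * \<sigma>)"
    by (intro esssup_I) (auto intro!: always_eventually ennreal_leI sup)
  then show ?thesis
    using True \<sigma> by (simp add: Lp_norm_def)
next
  case False
  define q where "q = enn2real p"
  have pq: "p = ennreal q"
    using False by (simp add: q_def less_top)
  have q: "1 \<le> q"
    using p unfolding pq by (simp add: ennreal_le_iff2 flip: ennreal_1)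
  have r: "enn2real (1 / p) = 1 / q"
    using q unfolding pq by (simp add: divide_ennreal flip: ennreal_1)
  have pt: "norm (f z) powr q \<le> (K * \<sigma>) powr (q - 1) * norm (f z)" for z
  proof (cases "f z = 0")
    case False
    have "norm (f z) powr q = norm (f z) powr (q - 1) * norm (f z)"
      using False powr_add[of "norm (f z)" "q - 1" 1] by simp
    also have "\<dots> \<le> (K * \<sigma>) powr (q - 1) * norm (f z)"
      using sup q by (intro mult_right_mono powr_mono2) auto
    finally show ?thesis .
  qed simp
  have "(\<integral>\<^sup>+z. ennreal (norm (f z) powr q) \<partial>lborel) \<le>
    (\<integral>\<^sup>+z. ennreal ((K * \<sigma>) powr (q - 1)) * ennreal (norm (f z)) \<partial>lborel)"
    by (intro nn_integral_mono) (auto simp: pt ennreal_mult[symmetric] intro!: ennreal_leI)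
  also have "\<dots> = ennreal ((K * \<sigma>) powr (q - 1)) * (\<integral>\<^sup>+z. ennreal (norm (f z)) \<partial>lborel)"
    by (rule nn_integral_cmult) simp
  also have "\<dots> \<le> ennreal ((K * \<sigma>) powr (q - 1)) * ennreal K"
    by (intro mult_left_mono L1) simp
  also have "\<dots> = ennreal ((K * \<sigma>) powr (q - 1) * K)"
    using K by (simp add: ennreal_mult)
  also have "(K * \<sigma>) powr (q - 1) * K = K powr q * \<sigma> powr (q - 1)"
    using K \<sigma> powr_add[of K "q - 1" 1] by (cases "K = 0") (auto simp: powr_mult)
  finally have I: "(\<integral>\<^sup>+z. ennreal (norm (f z) powr q) \<partial>lborel) \<le> ennreal (K powr q * \<sigma> powr (q - 1))" (is "?I \<le> _") .
  have "enn2real ?I powr (1 / q) \<le> (K powr q * \<sigma> powr (q - 1)) powr (1 / q)"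
    using I q by (intro powr_mono2 enn2real_leI) auto
  also have "\<dots> = K * \<sigma> powr ((q - 1) / q)"
    using K q by (simp add: powr_mult powr_powr)
  also have "(q - 1) / q = 1 - 1 / q"
    using q by (simp add: field_simps)
  finally show ?thesis
    using I False by (auto simp: Lp_norm_def Let_def r q_def[symmetric] top_unique intro: ennreal_leI)
qed

text \<open>The inverse of \<open>aniso_contract j\<close>. Being self-adjoint, it acts on
  frequencies and on points alike.\<close>

definition aniso_dilate :: "nat \<Rightarrow> 'a::euclidean_space \<times> 'a \<Rightarrow> 'a \<times> 'a" where
  "aniso_dilate j z = (2 ^ (3 * j) *\<^sub>R fst z, 2 ^ j *\<^sub>R snd z)"

text \<open>The Jacobian is 2^(3 j d) 2^(j d), which is where the exponent 4 j d of the estimate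
  comes from.\<close>

lemma lborel_aniso_dilate:
  "(lborel :: ('a::euclidean_space \<times> 'a) measure) =
    density (distr lborel borel (aniso_dilate j)) (\<lambda>_. ennreal (2 ^ (4 * DIM('a) * j)))"
proof -
  let ?c = "pair_weight (2 ^ j) (2 ^ (3 * j)) :: 'a \<times> 'a \<Rightarrow> real"
  have T: "0 + (\<Sum>b\<in>Basis. (?c b * (z \<bullet> b)) *\<^sub>R b) = aniso_dilate j z" for z :: "'a \<times> 'a"
  proof (rule euclidean_eqI)
    fix b :: "'a \<times> 'a" assume b: "b \<in> Basis"
    then have "(0 + (\<Sum>b\<in>Basis. (?c b * (z \<bullet> b)) *\<^sub>R b)) \<bullet> b = ?c b * (z \<bullet> b)"
      by (simp add: inner_sum_left inner_Basis if_distrib cong: if_cong)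
    also have "\<dots> = aniso_dilate j z \<bullet> b"
      using b by (auto simp: aniso_dilate_def pair_weight_def inner_prod_def Basis_prod_def)
    finally show "(0 + (\<Sum>b\<in>Basis. (?c b * (z \<bullet> b)) *\<^sub>R b)) \<bullet> b = aniso_dilate j z \<bullet> b" .
  qed
  have P: "(\<Prod>b\<in>Basis. \<bar>?c b\<bar>) = 2 ^ (4 * DIM('a) * j)"
    unfolding prod_pair_weight[of "\<lambda>s. \<bar>s\<bar>"]
    by (simp add: power_mult[symmetric] power_add[symmetric] algebra_simps)
  show ?thesis
    using lborel_affine_euclidean[of ?c 0] unfolding T P by (simp add: pair_weight_def)
qed

lemma aniso_dilate_measurable [measurable]: "aniso_dilate j \<in> borel_measurable borel"
  unfolding aniso_dilate_def[abs_def] by (intro borel_measurable_continuous_onI continuous_intros)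

lemma integral_aniso_dilate:
  fixes f :: "'a::euclidean_space \<times> 'a \<Rightarrow> complex"
  assumes [measurable]: "f \<in> borel_measurable borel"
  shows "(LINT z|lborel. f z) = of_real (2 ^ (4 * DIM('a) * j)) * (LINT z|lborel. f (aniso_dilate j z))"
  by (subst lborel_aniso_dilate[of j], subst integral_density)
    (simp_all add: integral_distr scaleR_conv_of_real)

lemma nn_integral_aniso_dilate:
  fixes f :: "'a::euclidean_space \<times> 'a \<Rightarrow> ennreal"
  assumes [measurable]: "f \<in> borel_measurable borel"
  shows "(\<integral>\<^sup>+z. f z \<partial>lborel) = ennreal (2 ^ (4 * DIM('a) * j)) * (\<integral>\<^sup>+z. f (aniso_dilate j z) \<partial>lborel)"
  by (subst lborel_aniso_dilate[of j], subst nn_integral_density)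
    (simp_all add: nn_integral_distr nn_integral_cmult)

lemma inner_aniso_dilate: "aniso_dilate j \<xi> \<bullet> z = \<xi> \<bullet> aniso_dilate j z"
  by (simp add: aniso_dilate_def inner_prod_def)

lemma block_symbol_aniso_dilate: "block_symbol chi j (aniso_dilate j \<xi>) = block_symbol chi 0 \<xi>"
proof -
  have "aniso_contract (j + n) (aniso_dilate j \<xi>) = aniso_contract n \<xi>" for n
    by (simp add: aniso_contract_def aniso_dilate_def case_prod_unfold power_add distrib_left)
  from this[of 0] this[of 1] show ?thesis
    by (simp add: block_symbol_def)
qed

text \<open>Substituting \<open>aniso_dilate j\<close> in the frequency integral turns block j into
  block 0 with a dilated symbol, and the result is a constant times \<sigma>
  \<Phi>(\<open>aniso_dilate j z\<close>). The supremum gains the factor \<sigma> while the L^1 norm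
  does not; interpolation then yields the power 2^(4 j (d - d/p)).\<close>

lemma aniso_block_Lp_norm:
  fixes chi :: "'d::finite phase \<Rightarrow> real" and f :: "'d phase \<Rightarrow> real"
  assumes FT: "\<And>\<xi>. (LINT z|lborel. cis (- (\<xi> \<bullet> z)) * of_real (f z)) = of_real (g \<xi>)"
    and [measurable]: "chi \<in> borel_measurable borel" "g \<in> borel_measurable borel"
    and bd: "osc_bounds (\<lambda>\<xi>. of_real (block_symbol chi 0 \<xi> * g (aniso_dilate j \<xi>))) K K"
    and p: "1 \<le> p"
  shows "Lp_norm p (aniso_block chi j f) \<le>
    ennreal (K * 2 powr (4 * real j * (real CARD('d) - real CARD('d) * enn2real (1 / p))))"
proof -
  define \<sigma> where "\<sigma> = (2::real) ^ (4 * CARD('d) * j)"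
  define c where "c = (2 * pi) powr (- real DIM('d phase) / 2)"
  define \<Phi> where "\<Phi> = osc_integral (\<lambda>\<xi>. complex_of_real (block_symbol chi 0 \<xi> * g (aniso_dilate j \<xi>)))"
  have [measurable]: "aniso_contract n \<in> borel_measurable (borel :: 'd phase measure)" for n
    unfolding aniso_contract_def case_prod_unfold
    by (intro borel_measurable_continuous_onI continuous_intros)
  have [measurable]: "block_symbol chi n \<in> borel_measurable borel" for n
    unfolding block_symbol_def[abs_def] by measurable
  have [measurable]: "\<Phi> \<in> borel_measurable borel"
    unfolding \<Phi>_def by (rule osc_integral_measurable) measurable
  \<comment> \<open>\<open>c\<close> is the normalising constant of each of the two transforms; it
    is at most 1 and gets dropped from the bounds.\<close>
  have c: "0 \<le> c" "c \<le> 1"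
    using powr_mono[of "- real DIM('d phase) / 2" 0 "2 * pi"] pi_ge_two by (auto simp: c_def)
  have \<sigma>: "0 < \<sigma>" by (simp add: \<sigma>_def)
  have fourier: "fourier (\<lambda>z. complex_of_real (f z)) \<xi> = of_real (c * g \<xi>)" for \<xi>
    unfolding fourier_def FT c_def by simp
  have block: "aniso_block chi j f z = of_real (c * c * \<sigma>) * \<Phi> (aniso_dilate j z)" for z
  proof -
    have "aniso_block chi j f z =
      of_real c * (LINT \<xi>|lborel. of_real c * (cis (\<xi> \<bullet> z) * of_real (block_symbol chi j \<xi> * g \<xi>)))"
      unfolding aniso_block_def inverse_fourier_def fourier c_def[symmetric]
      by (simp add: mult_ac)
    also have "\<dots> = of_real (c * c) * (LINT \<xi>|lborel. cis (\<xi> \<bullet> z) * of_real (block_symbol chi j \<xi> * g \<xi>))"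
      by (simp only: integral_mult_right_zero of_real_mult mult.assoc)
    also have "(LINT \<xi>|lborel. cis (\<xi> \<bullet> z) * of_real (block_symbol chi j \<xi> * g \<xi>)) =
      of_real \<sigma> * (LINT \<xi>|lborel. cis (aniso_dilate j \<xi> \<bullet> z) *
        of_real (block_symbol chi j (aniso_dilate j \<xi>) * g (aniso_dilate j \<xi>)))"
      by (subst integral_aniso_dilate[of _ j]) (simp_all add: \<sigma>_def)
    also have "(LINT \<xi>|lborel. cis (aniso_dilate j \<xi> \<bullet> z) *
        of_real (block_symbol chi j (aniso_dilate j \<xi>) * g (aniso_dilate j \<xi>))) = \<Phi> (aniso_dilate j z)"
      unfolding \<Phi>_def osc_integral_def block_symbol_aniso_dilate inner_aniso_dilate ..
    finally show ?thesis by (simp add: mult.assoc)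
  qed
  have bd': "\<And>z. norm (\<Phi> z) \<le> K" "(\<integral>\<^sup>+z. ennreal (norm (\<Phi> z)) \<partial>lborel) \<le> ennreal K"
    using bd by (auto simp: osc_bounds_def \<Phi>_def)
  have K: "0 \<le> K"
    using bd'(1)[of 0] norm_ge_zero order_trans by blast
  have cc: "c * c \<le> 1"
    using c by (simp add: mult_le_one)
  have norm: "norm (aniso_block chi j f z) = c * c * (\<sigma> * norm (\<Phi> (aniso_dilate j z)))" for z
    unfolding block using c \<sigma> by (simp add: norm_mult)
  have "Lp_norm p (aniso_block chi j f) \<le> ennreal (K * \<sigma> powr (1 - enn2real (1 / p)))"
  proof (rule Lp_norm_interpolation)
    show "aniso_block chi j f \<in> borel_measurable borel"
      unfolding block[abs_def] by measurable
    show "norm (aniso_block chi j f z) \<le> K * \<sigma>" for z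
    proof -
      have "c * c * (\<sigma> * norm (\<Phi> (aniso_dilate j z))) \<le> 1 * (\<sigma> * K)"
        using cc c \<sigma> bd'(1) by (intro mult_mono) auto
      then show ?thesis unfolding norm by (simp add: mult_ac)
    qed
    have "(\<integral>\<^sup>+z. ennreal (norm (aniso_block chi j f z)) \<partial>lborel) \<le>
      (\<integral>\<^sup>+z. ennreal \<sigma> * ennreal (norm (\<Phi> (aniso_dilate j z))) \<partial>lborel)"
    proof (rule nn_integral_mono)
      fix z :: "'d phase"
      have "c * c * (\<sigma> * norm (\<Phi> (aniso_dilate j z))) \<le> 1 * (\<sigma> * norm (\<Phi> (aniso_dilate j z)))"
        using cc \<sigma> by (intro mult_right_mono) auto
      then show "ennreal (norm (aniso_block chi j f z)) \<le> ennreal \<sigma> * ennreal (norm (\<Phi> (aniso_dilate j z)))"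
        unfolding norm using \<sigma> by (simp add: ennreal_leI flip: ennreal_mult)
    qed
    also have "\<dots> = ennreal \<sigma> * (\<integral>\<^sup>+z. ennreal (norm (\<Phi> (aniso_dilate j z))) \<partial>lborel)"
      by (rule nn_integral_cmult) measurable
    also have "\<dots> = (\<integral>\<^sup>+z. ennreal (norm (\<Phi> z)) \<partial>lborel)"
      unfolding \<sigma>_def by (subst (2) nn_integral_aniso_dilate[of _ j]) simp_all
    finally show "(\<integral>\<^sup>+z. ennreal (norm (aniso_block chi j f z)) \<partial>lborel) \<le> ennreal K"
      using bd'(2) by simp
  qed (use K \<sigma> p in auto)
  also have "\<sigma> powr (1 - enn2real (1 / p)) =
    2 powr (4 * real j * (real CARD('d) - real CARD('d) * enn2real (1 / p)))"
    unfolding \<sigma>_def by (simp add: powr_realpow[symmetric] powr_powr algebra_simps)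
  finally show ?thesis .
qed

section \<open>Uniform bounds for the heat factors\<close>

text \<open>The cube root of 8 is 2, so the isotropic factor 8 doubles the first summand and more
  than suffices for the second.\<close>

lemma aniso_norm_scaleR8: "2 * aniso_norm \<xi> \<le> aniso_norm (8 *\<^sub>R \<xi>)"
proof -
  have "root 3 (8 * x) = 2 * root 3 x" for x
    using real_root_power_cancel[of 3 2] by (simp add: real_root_mult)
  then show ?thesis by (simp add: aniso_norm_def case_prod_unfold)
qed

lemma aniso_norm_contract1: "aniso_norm (aniso_contract 1 \<xi>) = aniso_norm \<xi> / 2"
proof -
  have "root 3 (x / 8) = root 3 x / 2" for x
    using real_root_power_cancel[of 3 2] by (simp add: real_root_divide)
  then show ?thesis by (simp add: aniso_norm_def aniso_contract_def case_prod_unfold add_divide_distrib)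
qed

text \<open>A crude Euclidean ball containing the support of the block symbol: norm above 100 forces
  one component above 27 or the other above 3, and 3 exceeds 8/3, beyond which both cutoffs
  vanish.\<close>

lemma aniso_norm_large: "100 < norm \<xi> \<Longrightarrow> 3 < aniso_norm \<xi>"
proof -
  assume "100 < norm \<xi>"
  then have "100 < norm (fst \<xi>) + norm (snd \<xi>)"
    using norm_Pair_le[of "fst \<xi>" "snd \<xi>"] by simp
  then consider "27 < norm (fst \<xi>)" | "3 < norm (snd \<xi>)" by linarith
  then show ?thesis
  proof cases
    case 1
    have "root 3 27 = 3"
      using real_root_power_cancel[of 3 3] by simp
    then have "3 < root 3 (norm (fst \<xi>))"
      using 1 real_root_less_mono[of 3 27 "norm (fst \<xi>)"] by simp
    then show ?thesis
      using norm_ge_zero[of "snd \<xi>"] unfolding aniso_norm_def case_prod_unfold by linarith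
  next
    case 2
    then show ?thesis by (simp add: aniso_norm_def case_prod_unfold add_strict_increasing2)
  qed
qed

text \<open>Smoothness and bounded support feed \<open>smooth_osc_bounds\<close>; the distance from
  the origin is what permits division by powers of the norm.\<close>

lemma block_symbol_0_properties:
  assumes "aniso_cutoff chi"
  shows "smooth (block_symbol chi 0)" "100 < norm \<xi> \<Longrightarrow> block_symbol chi 0 \<xi> = 0"
    and "block_symbol chi 0 \<xi> \<noteq> 0 \<Longrightarrow> 1 < aniso_norm \<xi>"
proof -
  have chi: "smooth chi" "\<And>\<xi>. aniso_norm \<xi> \<le> 1 \<Longrightarrow> chi \<xi> = 1" "\<And>\<xi>. 4 / 3 < aniso_norm \<xi> \<Longrightarrow> chi \<xi> = 0"
    using assms by (auto simp: aniso_cutoff_def)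
  have c0: "aniso_contract 0 = (\<lambda>\<xi>. \<xi>)"
    by (auto simp: aniso_contract_def)
  have "bounded_linear (aniso_contract 1)"
    unfolding aniso_contract_def case_prod_unfold
    by (intro bounded_linear_Pair bounded_linear_compose[OF bounded_linear_scaleR_right bounded_linear_fst]
        bounded_linear_compose[OF bounded_linear_scaleR_right bounded_linear_snd])
  then have "smooth (\<lambda>\<xi>. chi (aniso_contract (0 + 1) \<xi>) - chi (aniso_contract 0 \<xi>))"
    unfolding c0 add_0 by (intro smooth_diff smooth_linear[OF chi(1)] chi(1))
  then show "smooth (block_symbol chi 0)"
    by (simp add: block_symbol_def[abs_def])
  show "block_symbol chi 0 \<xi> = 0" if "100 < norm \<xi>"
  proof -
    have "4 / 3 < aniso_norm \<xi>" "4 / 3 < aniso_norm (aniso_contract (Suc 0) \<xi>)"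
      using aniso_norm_large[OF that] unfolding aniso_norm_contract1[unfolded One_nat_def] by linarith+
    then show ?thesis
      using chi(3) by (simp add: block_symbol_def c0)
  qed
  show "1 < aniso_norm \<xi>" if "block_symbol chi 0 \<xi> \<noteq> 0"
  proof (rule ccontr)
    assume "\<not> 1 < aniso_norm \<xi>"
    then have "aniso_norm \<xi> \<le> 1" "aniso_norm (aniso_contract 1 \<xi>) \<le> 1"
      by (auto simp: aniso_norm_contract1[unfolded One_nat_def])
    then show False
      using that chi(2) by (simp add: block_symbol_def c0)
  qed
qed

text \<open>The quotient is a test function because the symbol vanishes near the origin; N = 0 gives
  the symbol itself.\<close>

lemma block_symbol_over_norm_bounds:
  fixes chi :: "'d::finite phase \<Rightarrow> real"
  assumes chi: "aniso_cutoff chi"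
  shows "\<exists>S>0. osc_bounds (\<lambda>\<xi>. of_real (block_symbol chi 0 \<xi> * inverse ((norm \<xi>)\<^sup>2) ^ N)) S S"
proof -
  \<comment> \<open>\<open>\<rho>\<close> agrees with \<open>\<bar>\<xi>\<bar>\<^sup>2\<close> on the support of the block symbol but does not vanish at the origin.\<close>
  define \<rho> where "\<rho> \<xi> = (norm \<xi>)\<^sup>2 + chi (8 *\<^sub>R \<xi>)" for \<xi> :: "'d phase"
  note B = block_symbol_0_properties[OF chi]
  have "aniso_norm (0 :: 'd phase) \<le> 1"
    by (simp add: aniso_norm_def case_prod_unfold)
  then have c: "smooth chi" "0 \<le> chi \<xi>" "chi 0 = 1" "4 / 3 < aniso_norm \<xi> \<Longrightarrow> chi \<xi> = 0" for \<xi>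
    using chi unfolding aniso_cutoff_def by blast+
  have \<rho>0: "\<rho> \<xi> \<noteq> 0" for \<xi>
  proof (cases "\<xi> = 0")
    case False
    then have "0 < (norm \<xi>)\<^sup>2" by simp
    then show ?thesis using c(2)[of "8 *\<^sub>R \<xi>"] unfolding \<rho>_def by linarith
  qed (simp add: \<rho>_def c)
  have "smooth \<rho>"
    unfolding \<rho>_def by (intro smooth_add smooth_norm_power2 smooth_linear[OF c(1)] bounded_linear_scaleR_right)
  then have sm: "smooth (\<lambda>\<xi>. block_symbol chi 0 \<xi> * inverse (\<rho> \<xi>) ^ N)"
    using \<rho>0 by (intro smooth_mult B smooth_power smooth_inverse)
  have "block_symbol chi 0 \<xi> * inverse (\<rho> \<xi>) ^ N = block_symbol chi 0 \<xi> * inverse ((norm \<xi>)\<^sup>2) ^ N" for \<xi>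
  proof (cases "block_symbol chi 0 \<xi> = 0")
    case False
    \<comment> \<open>On the support the anisotropic norm exceeds 1, hence exceeds 2 after scaling
      by 8, and the correction term in \<open>\<rho>\<close> is zero there.\<close>
    then have "4 / 3 < aniso_norm (8 *\<^sub>R \<xi>)"
      using B(3)[OF False] aniso_norm_scaleR8[of \<xi>] by linarith
    then show ?thesis by (simp add: \<rho>_def c)
  qed simp
  with smooth_osc_bounds[OF sm, of 100] show ?thesis
    using B(2) by simp
qed

text \<open>The left-hand form is half of m Q at time \<tau>. Its coefficients are of orders m
  \<tau> and m \<tau>^3, and the divisor 100 makes a small enough for the remainder to stay positive
  definite.\<close>

lemma sheared_form_split:
  fixes \<tau> m :: real
  assumes "0 < \<tau>" "0 < m"
  defines "a \<equiv> m * min \<tau> (\<tau> ^ 3) / 100"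
  shows "\<exists>\<alpha>>0. \<exists>\<beta>>0. \<exists>c. \<forall>\<xi> :: 'a::euclidean_space \<times> 'a.
    sheared_form (\<tau> * m / 2) (\<tau> ^ 3 * m / 24) (\<tau> / 2) \<xi> = sheared_form \<alpha> \<beta> c \<xi> + a * (norm \<xi>)\<^sup>2"
proof -
  \<comment> \<open>Coefficient matching: \<alpha> from |\<xi>2|^2, then c from the mixed term
    \<tau>^2 m / 4 = \<alpha> c, then \<beta> from |\<xi>1|^2. Positivity of \<beta> amounts to
    25/196 + 1/100 < 1/6.\<close>
  define \<alpha> where "\<alpha> = \<tau> * m / 2 - a"
  define c where "c = \<tau>\<^sup>2 * m / (4 * \<alpha>)"
  define \<beta> where "\<beta> = \<tau> ^ 3 * m / 6 - a - \<alpha> * c\<^sup>2"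
  have a1: "a \<le> \<tau> * m / 100" and a2: "a \<le> \<tau> ^ 3 * m / 100"
    using assms(1,2) by (auto simp: a_def mult.commute intro!: mult_right_mono)
  have pos: "0 < \<tau> * m" "0 < \<tau> ^ 3 * m" using assms(1,2) by auto
  have \<alpha>: "49 / 100 * (\<tau> * m) \<le> \<alpha>" "0 < \<alpha>"
    using a1 pos unfolding \<alpha>_def by linarith+
  have "\<alpha> * c\<^sup>2 = (\<tau>\<^sup>2 * m)\<^sup>2 / (16 * \<alpha>)"
    using \<alpha> by (simp add: c_def power2_eq_square field_simps)
  also have "\<dots> \<le> (\<tau>\<^sup>2 * m)\<^sup>2 / (16 * (49 / 100 * (\<tau> * m)))"
    by (rule frac_le) (use \<alpha>(1) pos(1) in simp_all)
  also have "\<dots> = 25 / 196 * (\<tau> ^ 3 * m)"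
    using assms(1,2) by (simp add: power2_eq_square power3_eq_cube field_simps)
  finally have \<beta>: "0 < \<beta>"
    unfolding \<beta>_def using a2 pos by linarith
  have expand: "sheared_form A B C \<xi> = A * (norm (snd \<xi>))\<^sup>2 + 2 * (A * C) * (snd \<xi> \<bullet> fst \<xi>) +
      (A * C\<^sup>2 + B) * (norm (fst \<xi>))\<^sup>2" for A B C and \<xi> :: "'a \<times> 'a"
    unfolding sheared_form_def case_prod_unfold power2_norm_eq_inner inner_add_left inner_add_right
      inner_scaleR_left inner_scaleR_right
    by (simp add: inner_commute[of "fst \<xi>" "snd \<xi>"] algebra_simps power2_eq_square)
  have "sheared_form (\<tau> * m / 2) (\<tau> ^ 3 * m / 24) (\<tau> / 2) \<xi> = sheared_form \<alpha> \<beta> c \<xi> + a * (norm \<xi>)\<^sup>2"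
    for \<xi> :: "'a \<times> 'a"
  proof -
    have n: "(norm \<xi>)\<^sup>2 = (norm (fst \<xi>))\<^sup>2 + (norm (snd \<xi>))\<^sup>2"
      by (simp add: power2_norm_eq_inner inner_prod_def)
    have coeffs: "\<alpha> * c = \<tau> * m / 2 * (\<tau> / 2)"
      "\<alpha> * c\<^sup>2 + \<beta> + a = \<tau> * m / 2 * (\<tau> / 2)\<^sup>2 + \<tau> ^ 3 * m / 24" "\<alpha> + a = \<tau> * m / 2"
      using \<alpha>(2) by (simp_all add: c_def \<beta>_def \<alpha>_def[symmetric] power2_eq_square power3_eq_cube)
        (simp add: \<alpha>_def)
    have "sheared_form \<alpha> \<beta> c \<xi> + a * (norm \<xi>)\<^sup>2 = (\<alpha> + a) * (norm (snd \<xi>))\<^sup>2 +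
      2 * (\<alpha> * c) * (snd \<xi> \<bullet> fst \<xi>) + (\<alpha> * c\<^sup>2 + \<beta> + a) * (norm (fst \<xi>))\<^sup>2"
      unfolding expand n by (simp add: algebra_simps)
    then show ?thesis
      unfolding coeffs expand[of "\<tau> * m / 2"] by simp
  qed
  then show ?thesis using \<alpha>(2) \<beta> by blast
qed

lemma osc_bounds_mono: "osc_bounds \<phi> S L \<Longrightarrow> S \<le> S' \<Longrightarrow> L \<le> L' \<Longrightarrow> osc_bounds \<phi> S' L'"
  unfolding osc_bounds_def by (meson ennreal_leI order_trans)

text \<open>\<open>K\<close> is fixed before \<tau> and m, so the bound is uniform. Only half of m Q
  is spent here; the other half stays free to absorb the polynomial factor that the
  \<zeta>-derivative produces.\<close>

lemma block_heat_bounds: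
  fixes chi :: "'d::finite phase \<Rightarrow> real"
  assumes chi: "aniso_cutoff chi" and ell: "0 \<le> ell"
  shows "\<exists>K>0. \<forall>\<tau>>0. \<forall>m>0.
    let q = sheared_form (\<tau> * m / 2) (\<tau> ^ 3 * m / 24) (\<tau> / 2); X = K * (1 / m * (1 / \<tau> + 1 / \<tau> ^ 3)) powr ell
    in osc_bounds (\<lambda>\<xi>. of_real (exp (- q \<xi>) * block_symbol chi 0 \<xi>)) X X"
proof -
  \<comment> \<open>The successor keeps \<open>N\<close> positive even for ell = 0, so that
    \<open>b = a / N\<close> makes sense.\<close>
  define N where "N = Suc (nat \<lceil>ell\<rceil>)"
  have N: "0 < N" "ell \<le> real N" by (auto simp: N_def) linarith
  obtain S0 where S0: "0 < S0" "osc_bounds (\<lambda>\<xi>. complex_of_real (block_symbol chi 0 \<xi>)) S0 S0"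
    using block_symbol_over_norm_bounds[OF chi, of 0] by auto
  obtain S where S: "0 < S" "osc_bounds (\<lambda>\<xi>. complex_of_real (block_symbol chi 0 \<xi> * inverse ((norm \<xi>)\<^sup>2) ^ N)) S S"
    using block_symbol_over_norm_bounds[OF chi, of N] by blast
  define D where "D = 2 * real CARD('d)"
  define K where "K = S0 + (100 * real N * D) ^ N * S"
  have D: "0 < D" by (simp add: D_def)
  have K: "0 < K" "S0 \<le> K" "(100 * real N * D) ^ N * S \<le> K"
    using S0(1) S(1) D by (auto simp: K_def intro!: add_pos_nonneg)
  show ?thesis
  proof (intro exI[of _ K] conjI allI impI K(1), unfold Let_def)
    fix \<tau> m :: real assume \<tau>: "0 < \<tau>" and m: "0 < m"
    define q where "q = (sheared_form (\<tau> * m / 2) (\<tau> ^ 3 * m / 24) (\<tau> / 2) :: 'd phase \<Rightarrow> real)"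
    define A where "A = 1 / m * (1 / \<tau> + 1 / \<tau> ^ 3)"
    define a where "a = m * min \<tau> (\<tau> ^ 3) / 100"
    define b where "b = a / real N"
    have A: "0 < A" unfolding A_def using \<tau> m by (intro mult_pos_pos add_pos_pos) auto
    have a: "0 < a" using \<tau> m by (simp add: a_def)
    have b: "0 < b" "a = real N * b" using a N by (simp_all add: b_def)
    \<comment> \<open>\<open>A\<close> is the bracket to be raised to the power ell; the sum
      1/\<tau> + 1/\<tau>^3 dominates the reciprocal of the minimum in \<open>a\<close>.\<close>
    have ab: "1 / b \<le> 100 * real N * A"
    proof -
      have "1 / min \<tau> (\<tau> ^ 3) \<le> 1 / \<tau> + 1 / \<tau> ^ 3"
        using \<tau> by (auto simp: min_def)
      then have "1 / m * (1 / min \<tau> (\<tau> ^ 3)) \<le> A"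
        unfolding A_def using m by (intro mult_left_mono) auto
      then have "100 * real N * (1 / m * (1 / min \<tau> (\<tau> ^ 3))) \<le> 100 * real N * A"
        by (intro mult_left_mono) auto
      then show ?thesis by (simp add: b_def a_def)
    qed
    have crude: "osc_bounds (\<lambda>\<xi>. of_real (exp (- q \<xi>) * block_symbol chi 0 \<xi>)) S0 S0"
      using osc_bounds_multiplier[OF sheared_gauss_multiplier(1) S0(2), of "\<tau> * m / 2" "\<tau> ^ 3 * m / 24" "\<tau> / 2"] \<tau> m
      by (simp add: q_def)
    have fine: "osc_bounds (\<lambda>\<xi>. of_real (exp (- q \<xi>) * block_symbol chi 0 \<xi>)) (K * A ^ N) (K * A ^ N)"
    proof -
      obtain \<alpha> \<beta> c where pos: "0 < \<alpha>" "0 < \<beta>"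
        and split: "\<And>\<xi> :: 'd phase. q \<xi> = sheared_form \<alpha> \<beta> c \<xi> + a * (norm \<xi>)\<^sup>2"
        using sheared_form_split[OF \<tau> m, where 'a = "real ^ 'd"] unfolding q_def a_def by blast
      let ?M = "\<lambda>\<xi>::'d phase. complex_of_real (sheared_form b b 0 \<xi> * exp (- sheared_form b b 0 \<xi>))"
      have iso: "sheared_form b b 0 \<xi> = b * (norm \<xi>)\<^sup>2" for \<xi> :: "'d phase"
        by (simp add: sheared_form_def case_prod_unfold power2_norm_eq_inner inner_prod_def algebra_simps)
      have M: "osc_bounds (\<lambda>\<xi>. ?M \<xi> ^ N * of_real (block_symbol chi 0 \<xi> * inverse ((norm \<xi>)\<^sup>2) ^ N)) (D ^ N * S) (D ^ N * S)"
        using osc_bounds_multiplier_power[OF sheared_gauss_multiplier(2)[OF b(1) b(1)] S(2)] by (simp add: D_def)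
      have "osc_bounds (\<lambda>\<xi>. of_real (exp (- sheared_form \<alpha> \<beta> c \<xi>)) * (of_real ((1 / b) ^ N) *
          (?M \<xi> ^ N * of_real (block_symbol chi 0 \<xi> * inverse ((norm \<xi>)\<^sup>2) ^ N))))
        (1 * (norm (complex_of_real ((1 / b) ^ N)) * (D ^ N * S))) (1 * (norm (complex_of_real ((1 / b) ^ N)) * (D ^ N * S)))"
        by (rule osc_bounds_multiplier[OF sheared_gauss_multiplier(1)[OF pos] osc_bounds_cmult[OF M]])
      also have "(\<lambda>\<xi>. of_real (exp (- sheared_form \<alpha> \<beta> c \<xi>)) * (of_real ((1 / b) ^ N) *
          (?M \<xi> ^ N * of_real (block_symbol chi 0 \<xi> * inverse ((norm \<xi>)\<^sup>2) ^ N)))) =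
        (\<lambda>\<xi>. complex_of_real (exp (- q \<xi>) * block_symbol chi 0 \<xi>))"
      proof
        fix \<xi> :: "'d phase"
        have "exp (- sheared_form \<alpha> \<beta> c \<xi>) * ((1 / b) ^ N * ((sheared_form b b 0 \<xi> * exp (- sheared_form b b 0 \<xi>)) ^ N *
          (block_symbol chi 0 \<xi> * inverse ((norm \<xi>)\<^sup>2) ^ N))) = exp (- q \<xi>) * block_symbol chi 0 \<xi>"
        proof (cases "block_symbol chi 0 \<xi> = 0")
          case False
          have "aniso_norm (0 :: 'd phase) = 0"
            by (simp add: aniso_norm_def case_prod_unfold)
          with block_symbol_0_properties(3)[OF chi False] have "\<xi> \<noteq> 0" by auto
          then have "(1 / b) ^ N * ((b * (norm \<xi>)\<^sup>2) ^ N * inverse ((norm \<xi>)\<^sup>2) ^ N) = 1"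
            using b by (simp add: power_mult_distrib[symmetric])
          moreover have "exp (- q \<xi>) = exp (- sheared_form \<alpha> \<beta> c \<xi>) * exp (- (b * (norm \<xi>)\<^sup>2)) ^ N"
            unfolding split b(2) exp_of_nat_mult[symmetric] exp_add[symmetric] by (simp add: algebra_simps)
          ultimately show ?thesis
            unfolding iso by (simp add: power_mult_distrib mult_ac)
        qed simp
        then show "of_real (exp (- sheared_form \<alpha> \<beta> c \<xi>)) * (of_real ((1 / b) ^ N) *
          (?M \<xi> ^ N * of_real (block_symbol chi 0 \<xi> * inverse ((norm \<xi>)\<^sup>2) ^ N))) =
          complex_of_real (exp (- q \<xi>) * block_symbol chi 0 \<xi>)"
          by (simp only: of_real_mult[symmetric] of_real_power[symmetric])
      qed
      finally show ?thesis
      proof (rule osc_bounds_mono)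
        have "(1 / b) ^ N * (D ^ N * S) \<le> (100 * real N * A) ^ N * (D ^ N * S)"
          using ab b S(1) D by (intro mult_right_mono power_mono) auto
        also have "\<dots> = ((100 * real N * D) ^ N * S) * A ^ N"
          by (simp add: power_mult_distrib)
        also have "\<dots> \<le> K * A ^ N"
          using K A by (intro mult_right_mono) auto
        finally show "1 * (norm (complex_of_real ((1 / b) ^ N)) * (D ^ N * S)) \<le> K * A ^ N"
          "1 * (norm (complex_of_real ((1 / b) ^ N)) * (D ^ N * S)) \<le> K * A ^ N"
          using b by (simp_all add: norm_power norm_divide power_divide)
      qed
    qed
    \<comment> \<open>Passage to a real exponent: if A <= 1, then A^N <= A^ell since N >= ell;
      otherwise A^ell >= 1 and the bound without decay is enough.\<close>
    have "osc_bounds (\<lambda>\<xi>. of_real (exp (- q \<xi>) * block_symbol chi 0 \<xi>)) (K * A powr ell) (K * A powr ell)"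
    proof (cases "A \<le> 1")
      case True
      then have "A ^ N \<le> A powr ell"
        using powr_mono'[of ell "real N" A] N A by (simp add: powr_realpow)
      then show ?thesis
        using K by (intro osc_bounds_mono[OF fine]) auto
    next
      case False
      then have "1 \<le> A powr ell"
        using ell by (simp add: ge_one_powr_ge_zero)
      then have "S0 * 1 \<le> K * A powr ell"
        using K S0(1) by (intro mult_mono) auto
      then show ?thesis
        by (intro osc_bounds_mono[OF crude]) auto
    qed
    then show "osc_bounds (\<lambda>\<xi>. of_real (exp (- sheared_form (\<tau> * m / 2) (\<tau> ^ 3 * m / 24) (\<tau> / 2) \<xi>) * block_symbol chi 0 \<xi>))
        (K * (1 / m * (1 / \<tau> + 1 / \<tau> ^ 3)) powr ell) (K * (1 / m * (1 / \<tau> + 1 / \<tau> ^ 3)) powr ell)"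
      by (simp add: q_def A_def)
  qed
qed

section \<open>The transported kernel, its \<zeta>-derivative and its scaling\<close>

text \<open>Completing the square: after transport the numerator of the exponent becomes 12 |x -
  (t/2) v|^2 + t^2 |v|^2.\<close>

lemma transport_kinetic_kernel:
  fixes z :: "'d::finite phase"
  assumes "0 < t" "0 < deriv \<Psi> s"
  shows "transport t (\<lambda>w. kinetic_kernel \<Psi> t w s) z =
    sheared_gauss (t * deriv \<Psi> s) (t ^ 3 * deriv \<Psi> s / 12) (t / 2) z"
proof -
  let ?m = "deriv \<Psi> s"
  obtain x v where z: "z = (x, v)" by (cases z)
  have pre: "4 * pi * (t * ?m) * (4 * pi * (t ^ 3 * ?m / 12)) = 4 * pi\<^sup>2 * t ^ 4 * ?m\<^sup>2 / 3"
    by (simp add: power2_eq_square power3_eq_cube power4_eq_xxxx)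
  have "3 * (norm (x - t *\<^sub>R v))\<^sup>2 + (norm (3 *\<^sub>R (x - t *\<^sub>R v) + (2 * t) *\<^sub>R v))\<^sup>2 =
    12 * (norm (x - (t / 2) *\<^sub>R v))\<^sup>2 + t\<^sup>2 * (norm v)\<^sup>2"
    unfolding power2_norm_eq_inner inner_add_left inner_add_right inner_diff_left inner_diff_right
      inner_scaleR_left inner_scaleR_right
    by (simp add: inner_commute[of v x] algebra_simps power2_eq_square)
  then have dual: "(3 * (norm (x - t *\<^sub>R v))\<^sup>2 + (norm (3 *\<^sub>R (x - t *\<^sub>R v) + (2 * t) *\<^sub>R v))\<^sup>2) / (4 * t ^ 3 * ?m) =
    sheared_dual (t * ?m) (t ^ 3 * ?m / 12) (t / 2) z"
    using assms by (simp add: z sheared_dual_def field_simps power2_eq_square power3_eq_cube)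
  show ?thesis
    unfolding sheared_gauss_def pre dual[symmetric] unfolding z transport_def kinetic_kernel_def minus_divide_left by simp
qed

text \<open>The kernel depends on \<zeta> only through y = \<Psi>'(\<zeta>), as a constant times
  y^(-d) exp (- E / y). Its logarithmic derivative in y is (E / y - d) / y, and E / y is
  \<open>sheared_dual\<close>.\<close>

lemma deriv_transport_kinetic_kernel:
  fixes z :: "'d::finite phase"
  assumes \<Psi>: "coefficient_assumption \<Psi>" and t: "0 < t" and \<zeta>: "0 < \<zeta>"
  defines "\<alpha> \<equiv> t * deriv \<Psi> \<zeta>" and "\<beta> \<equiv> t ^ 3 * deriv \<Psi> \<zeta> / 12"
  shows "deriv (\<lambda>s. transport t (\<lambda>w. kinetic_kernel \<Psi> t w s) z) \<zeta> =
    deriv (deriv \<Psi>) \<zeta> / deriv \<Psi> \<zeta> *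
      (sheared_dual \<alpha> \<beta> (t / 2) z * sheared_gauss \<alpha> \<beta> (t / 2) z - real CARD('d) * sheared_gauss \<alpha> \<beta> (t / 2) z)"
proof -
  let ?m = "deriv \<Psi>"
  have pos: "0 < ?m s" if "0 < s" for s
    using \<Psi> that by (auto simp: coefficient_assumption_def)
  have "?m differentiable (at \<zeta>)"
    using \<Psi> \<zeta> by (auto simp: coefficient_assumption_def)
  then have der: "(?m has_real_derivative deriv ?m \<zeta>) (at \<zeta>)"
    using DERIV_deriv_iff_real_differentiable by blast
  define E where "E = sheared_dual t (t ^ 3 / 12) (t / 2) z"
  define c where "c = 4 * pi * t * (4 * pi * (t ^ 3 / 12))"
  have c: "0 < c" using t by (simp add: c_def)
  have dual: "sheared_dual (t * y) (t ^ 3 * y / 12) (t / 2) z = E / y" for y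
    by (simp add: E_def sheared_dual_def case_prod_unfold add_divide_distrib mult_ac)
  have gauss: "sheared_gauss (t * y) (t ^ 3 * y / 12) (t / 2) z = (c * y\<^sup>2) powr (- real CARD('d) / 2) * exp (- (E / y))" for y
    unfolding sheared_gauss_def dual by (simp add: c_def power2_eq_square mult_ac)
  have G: "((\<lambda>s. (c * (?m s)\<^sup>2) powr (- real CARD('d) / 2) * exp (- (E / ?m s))) has_real_derivative
     deriv ?m \<zeta> / ?m \<zeta> * ((E / ?m \<zeta> - real CARD('d)) * ((c * (?m \<zeta>)\<^sup>2) powr (- real CARD('d) / 2) * exp (- (E / ?m \<zeta>))))) (at \<zeta>)"
  proof -
    have sq: "((\<lambda>s. c * (?m s)\<^sup>2) has_real_derivative c * (2 * ?m \<zeta> * deriv ?m \<zeta>)) (at \<zeta>)"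
      by (auto intro!: derivative_eq_intros der)
    define W where "W = (c * (?m \<zeta>)\<^sup>2) powr (- real CARD('d) / 2)"
    define r where "r = deriv ?m \<zeta> / ?m \<zeta>"
    have "(- real CARD('d) / 2) * (c * (?m \<zeta>)\<^sup>2) powr (- real CARD('d) / 2 - of_nat 1) * (c * (2 * ?m \<zeta> * deriv ?m \<zeta>)) =
      - real CARD('d) * W * r"
      using pos[OF \<zeta>] c by (simp add: powr_diff W_def r_def power2_eq_square)
    then have 1: "((\<lambda>s. (c * (?m s)\<^sup>2) powr (- real CARD('d) / 2)) has_real_derivative - real CARD('d) * W * r) (at \<zeta>)"
      using DERIV_fun_powr[OF sq, of "- real CARD('d) / 2"] pos[OF \<zeta>] c by (simp only: zero_less_power mult_pos_pos)
    have "((\<lambda>s. - (E / ?m s)) has_real_derivative E * r / ?m \<zeta>) (at \<zeta>)"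
      using pos[OF \<zeta>] by (auto intro!: derivative_eq_intros der simp: r_def)
    then have 2: "((\<lambda>s. exp (- (E / ?m s))) has_real_derivative exp (- (E / ?m \<zeta>)) * (E * r / ?m \<zeta>)) (at \<zeta>)"
      by (rule DERIV_fun_exp)
    show ?thesis
      unfolding r_def[symmetric]
      by (rule DERIV_cong[OF DERIV_mult[OF 1[unfolded W_def] 2]]) (simp add: algebra_simps)
  qed
  \<comment> \<open>The closed formula is available only where \<Psi>' is known to be positive,
    hence the comparison on the open half-line.\<close>
  have "deriv (\<lambda>s. transport t (\<lambda>w. kinetic_kernel \<Psi> t w s) z) \<zeta> =
    deriv ?m \<zeta> / ?m \<zeta> * ((E / ?m \<zeta> - real CARD('d)) * ((c * (?m \<zeta>)\<^sup>2) powr (- real CARD('d) / 2) * exp (- (E / ?m \<zeta>))))"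
  proof (rule DERIV_imp_deriv, rule has_field_derivative_transform_within_open[OF G, of "{0<..}"])
    fix s :: real assume "s \<in> {0<..}"
    then show "(c * (?m s)\<^sup>2) powr (- real CARD('d) / 2) * exp (- (E / ?m s)) =
      transport t (\<lambda>w. kinetic_kernel \<Psi> t w s) z"
      using transport_kinetic_kernel[of t \<Psi> s z] pos t by (simp add: gauss)
  qed (use \<zeta> in auto)
  then show ?thesis
    unfolding \<alpha>_def \<beta>_def dual gauss by (simp add: left_diff_distrib)
qed

text \<open>The dilation is absorbed entirely by the time, t becoming 2^(2 j) t, while m is
  unchanged; this reduces all blocks to j = 0.\<close>

lemma sheared_form_aniso_dilate:
  fixes t m :: real
  shows "sheared_form (t * m) (t ^ 3 * m / 12) (t / 2) (aniso_dilate j (\<xi> :: 'a::euclidean_space \<times> 'a)) =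
    sheared_form (2 ^ (2 * j) * t * m) ((2 ^ (2 * j) * t) ^ 3 * m / 12) (2 ^ (2 * j) * t / 2) \<xi>"
proof -
  have v: "2 ^ j *\<^sub>R snd \<xi> + (t / 2) *\<^sub>R (2 ^ (3 * j) *\<^sub>R fst \<xi>) = 2 ^ j *\<^sub>R (snd \<xi> + (2 ^ (2 * j) * t / 2) *\<^sub>R fst \<xi>)"
    by (simp add: scaleR_add_right flip: mult.assoc power_add)
  have n: "(norm (2 ^ i *\<^sub>R w))\<^sup>2 = 2 ^ (2 * i) * (norm w)\<^sup>2" for i and w :: 'a
    by (simp add: power_mult_distrib mult.commute flip: power_mult)
  have t3: "(2 ^ (2 * j) * t) ^ 3 = 2 ^ (2 * (3 * j)) * t ^ 3"
    by (simp add: power_mult_distrib flip: power_mult)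
  show ?thesis
    unfolding sheared_form_def aniso_dilate_def case_prod_unfold fst_conv snd_conv v n t3 by simp
qed

lemma sheared_form_measurable [measurable]:
  "sheared_form \<alpha> \<beta> c \<in> borel_measurable borel"
  unfolding sheared_form_def case_prod_unfold
  by (intro borel_measurable_continuous_onI continuous_intros)

theorem lemma3p1:
  fixes chi :: "'d::finite phase \<Rightarrow> real"
    and k :: nat and ell :: real and p :: ennreal
  assumes "aniso_cutoff chi"
    and "k \<in> {0, 1}" and "0 \<le> ell" and "1 \<le> p"
  shows "\<exists>C::real. C > 0 \<and>
    (\<forall>\<Psi>. coefficient_assumption \<Psi> \<longrightarrow>
      (\<forall>t>0. \<forall>\<zeta>>0. \<forall>j::nat.
        Lp_norm p (aniso_block chi j
            (\<lambda>z. (deriv ^^ k) (\<lambda>s. transport t (\<lambda>w. kinetic_kernel \<Psi> t w s) z) \<zeta>))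
        \<le> ennreal
            (C * 2 powr (4 * real j * (real CARD('d) - real CARD('d) * enn2real (1 / p)))
               * \<bar>deriv (deriv \<Psi>) \<zeta> / deriv \<Psi> \<zeta>\<bar> ^ k
               * (1 / deriv \<Psi> \<zeta> * (1 / (2 ^ (2 * j) * t) + 1 / (2 ^ (6 * j) * t ^ 3))) powr ell)))"
proof -
  obtain K where K: "0 < K" and bd: "\<And>\<tau> m. 0 < \<tau> \<Longrightarrow> 0 < m \<Longrightarrow>
      osc_bounds (\<lambda>\<xi>::'d phase. of_real (exp (- sheared_form (\<tau> * m / 2) (\<tau> ^ 3 * m / 24) (\<tau> / 2) \<xi>) * block_symbol chi 0 \<xi>))
        (K * (1 / m * (1 / \<tau> + 1 / \<tau> ^ 3)) powr ell) (K * (1 / m * (1 / \<tau> + 1 / \<tau> ^ 3)) powr ell)"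
    using block_heat_bounds[OF assms(1,3)] unfolding Let_def by blast
  \<comment> \<open>The case k = 1 costs |- 2 r| times the multiplier bound 2 d, hence 4 d K; the
    case k = 0 needs only K.\<close>
  define C where "C = 4 * real CARD('d) * K"
  have "1 \<le> real CARD('d)"
    using zero_less_card_finite[where 'a = 'd] by simp
  then have "1 * K \<le> 4 * real CARD('d) * K"
    using K by (intro mult_right_mono) linarith+
  then have C: "0 < C" "K \<le> C"
    using K unfolding C_def by linarith+
  have chi: "chi \<in> borel_measurable borel"
    using assms(1) by (auto simp: aniso_cutoff_def intro!: borel_measurable_continuous_onI smooth_continuous)
  show ?thesis
  proof (intro exI[of _ C] conjI C(1) allI impI)
    fix \<Psi> :: "real \<Rightarrow> real" and t \<zeta> :: real and j :: nat
    assume \<Psi>: "coefficient_assumption \<Psi>" and t: "0 < t" and \<zeta>: "0 < \<zeta>"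
    define m where "m = deriv \<Psi> \<zeta>"
    define r where "r = deriv (deriv \<Psi>) \<zeta> / m"
    define \<tau> where "\<tau> = 2 ^ (2 * j) * t"
    define X where "X = (1 / m * (1 / \<tau> + 1 / \<tau> ^ 3)) powr ell"
    define q where "q = (sheared_form (t * m) (t ^ 3 * m / 12) (t / 2) :: 'd phase \<Rightarrow> real)"
    \<comment> \<open>\<open>h\<close> is half of the dilated form. One factor exp (- h) is spent on
      the decay in \<open>B\<close>; the other acts as a multiplier, alone if k = 0 and together
      with h if k = 1.\<close>
    define h where "h = (sheared_form (\<tau> * m / 2) (\<tau> ^ 3 * m / 24) (\<tau> / 2) :: 'd phase \<Rightarrow> real)"
    have m: "0 < m" using \<Psi> \<zeta> by (auto simp: m_def coefficient_assumption_def)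
    have \<tau>: "0 < \<tau>" using t by (simp add: \<tau>_def)
    have X: "0 \<le> X" by (simp add: X_def)
    have ab: "0 < t * m" "0 < t ^ 3 * m / 12" using t m by auto
    have qh: "q (aniso_dilate j \<xi>) = 2 * h \<xi>" for \<xi>
      unfolding q_def sheared_form_aniso_dilate \<tau>_def[symmetric]
      by (simp add: h_def sheared_form_def case_prod_unfold distrib_left)
    have q [measurable]: "q \<in> borel_measurable borel"
      by (simp add: q_def)
    have B: "osc_bounds (\<lambda>\<xi>. complex_of_real (exp (- h \<xi>) * block_symbol chi 0 \<xi>)) (K * X) (K * X)"
      using bd[OF \<tau> m] by (simp add: h_def X_def)
    have hM: "L1_multiplier (\<lambda>\<xi>::'d phase. complex_of_real (exp (- h \<xi>))) 1"
      "L1_multiplier (\<lambda>\<xi>::'d phase. complex_of_real (h \<xi> * exp (- h \<xi>))) (2 * real CARD('d))"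
      using sheared_gauss_multiplier[of "\<tau> * m / 2" "\<tau> ^ 3 * m / 24" "\<tau> / 2", where 'a = "real ^ 'd"] \<tau> m
      by (simp_all add: h_def)
    have exp2: "exp (- (2 * h \<xi>)) = exp (- h \<xi>) * exp (- h \<xi>)" for \<xi>
      by (simp flip: exp_add)
    let ?f = "\<lambda>z. (deriv ^^ k) (\<lambda>s. transport t (\<lambda>w. kinetic_kernel \<Psi> t w s) z) \<zeta>"
    obtain g where FT: "\<And>\<xi>. (LINT z|lborel. cis (- (\<xi> \<bullet> z)) * of_real (?f z)) = of_real (g \<xi>)"
      and gm: "g \<in> borel_measurable borel"
      and gb: "osc_bounds (\<lambda>\<xi>. of_real (block_symbol chi 0 \<xi> * g (aniso_dilate j \<xi>))) (C * \<bar>r\<bar> ^ k * X) (C * \<bar>r\<bar> ^ k * X)"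
    proof -
      note F = sheared_gauss_fourier[OF ab, of "t / 2", where 'a = "real ^ 'd"]
      consider "k = 0" | "k = 1" using assms(2) by auto
      then show thesis
      proof cases
        case 1
        show ?thesis
        proof (rule that[of "\<lambda>\<xi>. exp (- q \<xi>)"])
          show "(LINT z|lborel. cis (- (\<xi> \<bullet> z)) * of_real (?f z)) = of_real (exp (- q \<xi>))" for \<xi>
            using F(1)[of \<xi>] 1 t m transport_kinetic_kernel[of t \<Psi> \<zeta>, where 'd = 'd]
            by (simp add: has_bochner_integral_iff q_def m_def mult.commute)
          have eq: "complex_of_real (block_symbol chi 0 \<xi> * exp (- q (aniso_dilate j \<xi>))) =
              complex_of_real (exp (- h \<xi>)) * complex_of_real (exp (- h \<xi>) * block_symbol chi 0 \<xi>)" for \<xi>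
            unfolding qh exp2 by simp
          have "osc_bounds (\<lambda>\<xi>. complex_of_real (exp (- h \<xi>)) * complex_of_real (exp (- h \<xi>) * block_symbol chi 0 \<xi>)) (1 * (K * X)) (1 * (K * X))"
            by (rule osc_bounds_multiplier[OF hM(1) B])
          then show "osc_bounds (\<lambda>\<xi>. of_real (block_symbol chi 0 \<xi> * exp (- q (aniso_dilate j \<xi>)))) (C * \<bar>r\<bar> ^ k * X) (C * \<bar>r\<bar> ^ k * X)"
            unfolding eq by (rule osc_bounds_mono) (use C X 1 in \<open>simp_all add: mult_right_mono\<close>)
        qed measurable
      next
        case 2
        show ?thesis
        \<comment> \<open>The derivative is r times (\<open>sheared_dual\<close> - d) times the
          Gaussian, and (d - q) exp (- q) - d exp (- q) = - q exp (- q).\<close>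
        proof (rule that[of "\<lambda>\<xi>. - r * (q \<xi> * exp (- q \<xi>))"])
          fix \<xi> :: "'d phase"
          let ?\<alpha> = "t * m" and ?\<beta> = "t ^ 3 * m / 12"
          have "has_bochner_integral lborel (\<lambda>z::'d phase. of_nat CARD('d) * (of_real (sheared_gauss ?\<alpha> ?\<beta> (t / 2) z) * cis (- (\<xi> \<bullet> z))))
            (of_nat CARD('d) * of_real (exp (- q \<xi>)))"
            unfolding q_def by (rule has_bochner_integral_mult_right) (rule F(1))
          from has_bochner_integral_diff[OF F(2)[of \<xi>] this]
          have I: "has_bochner_integral lborel (\<lambda>z::'d phase. cis (- (\<xi> \<bullet> z)) * of_real
              (sheared_dual ?\<alpha> ?\<beta> (t / 2) z * sheared_gauss ?\<alpha> ?\<beta> (t / 2) z - real CARD('d) * sheared_gauss ?\<alpha> ?\<beta> (t / 2) z))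
            (of_real (- (q \<xi> * exp (- q \<xi>))))"
            unfolding q_def by (simp add: algebra_simps)
          have "has_bochner_integral lborel (\<lambda>z::'d phase. of_real r * (cis (- (\<xi> \<bullet> z)) * of_real
              (sheared_dual ?\<alpha> ?\<beta> (t / 2) z * sheared_gauss ?\<alpha> ?\<beta> (t / 2) z - real CARD('d) * sheared_gauss ?\<alpha> ?\<beta> (t / 2) z)))
            (of_real r * of_real (- (q \<xi> * exp (- q \<xi>))))"
            by (rule has_bochner_integral_mult_right) (rule I)
          then show "(LINT z|lborel. cis (- (\<xi> \<bullet> z)) * of_real (?f z)) = of_real (- r * (q \<xi> * exp (- q \<xi>)))"
            using 2 deriv_transport_kinetic_kernel[OF \<Psi> t \<zeta>, where 'd = 'd]
            by (simp add: has_bochner_integral_iff m_def[symmetric] r_def[symmetric] mult_ac)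
        next
          have eq: "complex_of_real (block_symbol chi 0 \<xi> * (- r * (q (aniso_dilate j \<xi>) * exp (- q (aniso_dilate j \<xi>))))) =
              of_real (- 2 * r) * (complex_of_real (h \<xi> * exp (- h \<xi>)) * complex_of_real (exp (- h \<xi>) * block_symbol chi 0 \<xi>))" for \<xi>
            unfolding qh exp2 by simp
          have "osc_bounds (\<lambda>\<xi>. of_real (- 2 * r) * (complex_of_real (h \<xi> * exp (- h \<xi>)) * complex_of_real (exp (- h \<xi>) * block_symbol chi 0 \<xi>)))
            (norm (complex_of_real (- 2 * r)) * (2 * real CARD('d) * (K * X))) (norm (complex_of_real (- 2 * r)) * (2 * real CARD('d) * (K * X)))"
            by (intro osc_bounds_cmult osc_bounds_multiplier[OF hM(2) B])
          then show "osc_bounds (\<lambda>\<xi>. of_real (block_symbol chi 0 \<xi> * (- r * (q (aniso_dilate j \<xi>) * exp (- q (aniso_dilate j \<xi>))))))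
            (C * \<bar>r\<bar> ^ k * X) (C * \<bar>r\<bar> ^ k * X)"
            unfolding eq by (rule osc_bounds_mono) (use 2 in \<open>simp_all add: C_def norm_mult\<close>)
        qed measurable
      qed
    qed
    \<comment> \<open>The cube of 2^(2 j) t accounts for the term 2^(-6 j) t^(-3).\<close>
    have \<tau>3: "\<tau> ^ 3 = 2 ^ (6 * j) * t ^ 3"
      by (simp add: \<tau>_def power_mult_distrib flip: power_mult)
    show "Lp_norm p (aniso_block chi j ?f) \<le> ennreal
            (C * 2 powr (4 * real j * (real CARD('d) - real CARD('d) * enn2real (1 / p)))
               * \<bar>deriv (deriv \<Psi>) \<zeta> / deriv \<Psi> \<zeta>\<bar> ^ k
               * (1 / deriv \<Psi> \<zeta> * (1 / (2 ^ (2 * j) * t) + 1 / (2 ^ (6 * j) * t ^ 3))) powr ell)"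
      using aniso_block_Lp_norm[OF FT chi gm gb assms(4)]
      unfolding m_def[symmetric] \<tau>_def[symmetric] \<tau>3[symmetric] r_def[symmetric] X_def[symmetric]
      by (simp only: mult_ac)
  qed
qed

end
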